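(* There is a constant $c=c(A,B,C,\Omega)$ depending only on $A,B,C$ and $\Omega$ such that, for $L_2\geq\frac{\lambda^2}{L}c(A,B,C,\Omega)$, the critical points of the energy functional $J$ in the restricted admissible space $$\mathcal{A}_*=\Big\{(q_1,q_2,q_3)\in\mathcal{A}_0:\int_\Omega|\nabla q_1|^2\leq M_1(A,B,C),\ \int_\Omega|\nabla q_2|^2\leq M_2(A,B,C),\ \int_\Omega|\nabla q_3|^2\leq M_3(A,B,C)\Big\}$$ are locally stable with respect to the perturbations $$\mathbf{V}(x,y)=v_1(x,y)(\hat{\mathbf{x}}\otimes\hat{\mathbf{x}}-\hat{\mathbf{y}}\otimes\hat{\mathbf{y}})+v_2(x,y)(\hat{\mathbf{x}}\otimes\hat{\mathbf{y}}+\hat{\mathbf{y}}\otimes\hat{\mathbf{x}})$$ and $$\mathbf{V}(x,y)=v_3(x,y)(2\hat{\mathbf{z}}\otimes\hat{\mathbf{z}}-\hat{\mathbf{x}}\otimes\hat{\mathbf{x}}-\hat{\mathbf{y}}\otimes\hat{\mathbf{y}}),$$ where $v_1,v_2,v_3\in W_0^{1,2}(\Omega)$.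
   Context: Parameters: $A<0$, $B,C,L,\lambda>0$ and $L_2\in(-1,\infty)$ are real constants, and $s_+=\frac{B+\sqrt{B^2+24|A|C}}{4C}>0$. $M_1,M_2,M_3$ are given positive constants depending only on $A,B,C$. $\hat{\mathbf{x}},\hat{\mathbf{y}},\hat{\mathbf{z}}$ are the standard unit vectors of $\mathbb{R}^3$. Domain: for a fixed small $\epsilon>0$ ($\epsilon\ll1$), $\Omega=\{(x,y)\in\mathbb{R}^2:|x|<1,|y|<1,|x+y|<2-\epsilon,|x-y|<2-\epsilon\}$. Its boundary consists of four long edges, labelled clockwise, $C_1$ (on $y=1$), $C_2$ (on $x=1$), $C_3$ (on $y=-1$), $C_4$ (on $x=-1$), and four short edges, labelled clockwise from the top left, $S_1$ (on $y-x=2-\epsilon$), $S_2$ (on $x+y=2-\epsilon$), $S_3$ (on $x-y=2-\epsilon$), $S_4$ (on $x+y=-(2-\epsilon)$). Boundary function: with $g(l)=\frac{s_+}{2\epsilon}l$ for $-\epsilon\le l\le\epsilon$, define $q_b=s_+/2$ on $C_1\cup C_3$, $q_b=-s_+/2$ on $C_2\cup C_4$, $q_b=g(x+y)$ on $S_1$, $q_b=g(y-x)$ on $S_2$, $q_b=g(-x-y)$ on $S_3$, $q_b=g(x-y)$ on $S_4$. Energy: $J[q_1,q_2,q_3]=\int_\Omega f_{el}(q_1,q_2,q_3)+\frac{\lambda^2}{L}f_b(q_1,q_2,q_3)\,\mathrm{dA}$, where \begin{align*} f_{el}=&\Big(1+\tfrac{L_2}{2}\Big)|\nabla q_1|^2+\Big(1+\tfrac{L_2}{2}\Big)|\nabla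 q_2|^2+\Big(3+\tfrac{L_2}{2}\Big)|\nabla q_3|^2\\&+L_2(q_{1,y}q_{3,y}-q_{1,x}q_{3,x}-q_{2,y}q_{3,x}-q_{2,x}q_{3,y})+|L_2|(q_{2,y}q_{1,x}-q_{1,y}q_{2,x}),\\ f_b=&A(q_1^2+q_2^2+3q_3^2)+C(q_1^2+q_2^2+3q_3^2)^2+2Bq_3(q_1^2+q_2^2-q_3^2). \end{align*} The admissible space is $\mathcal{A}_0=\{(q_1,q_2,q_3)\in W^{1,2}(\Omega;\mathbb{R}^3):q_1=q_b,\ q_2=0,\ q_3=-s_+/6\text{ on }\partial\Omega\}$. A critical point of $J$ is a (weak) solution in $\mathcal{A}_0$ of the Euler-Lagrange equations of $J$. The triple $(q_1,q_2,q_3)$ corresponds to the tensor $\mathbf{Q}=q_1(\hat{\mathbf{x}}\otimes\hat{\mathbf{x}}-\hat{\mathbf{y}}\otimes\hat{\mathbf{y}})+q_2(\hat{\mathbf{x}}\otimes\hat{\mathbf{y}}+\hat{\mathbf{y}}\otimes\hat{\mathbf{x}})+q_3(2\hat{\mathbf{z}}\otimes\hat{\mathbf{z}}-\hat{\mathbf{x}}\otimes\hat{\mathbf{x}}-\hat{\mathbf{y}}\otimes\hat{\mathbf{y}})$. A perturbation $\mathbf{Q}+t\mathbf{V}$, with $\mathbf{V}$ vanishing on $\partial\Omega$, thus replaces $(q_1,q_2,q_3)$ by $(q_1+tv_1,q_2+tv_2,q_3)$ for the first class and by $(q_1,q_2,q_3+tv_3)$ for the second. A critical point is locally stable with respect to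 a class of perturbations if the second variation $\frac{d^2}{dt^2}J\big|_{t=0}$ is positive for all non-zero perturbations in that class. *)

theory Defs
  imports "HOL-Analysis.Analysis"
begin

primrec Ck :: "nat \<Rightarrow> ('a::euclidean_space \<Rightarrow> real) \<Rightarrow> bool" where
  "Ck 0 f \<longleftrightarrow> continuous_on UNIV f"
| "Ck (Suc k) f \<longleftrightarrow> (\<forall>x. f differentiable (at x)) \<and>
     (\<forall>b\<in>Basis. Ck k (\<lambda>x. frechet_derivative f (at x) b))"

definition test_functions :: "'a::euclidean_space set \<Rightarrow> ('a \<Rightarrow> real) set" where
  "test_functions S = {\<phi>. (\<forall>k. Ck k \<phi>) \<and>
     compact (closure {x. \<phi> x \<noteq> 0}) \<and> closure {x. \<phi> x \<noteq> 0} \<subseteq> S}"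

definition square_integrable :: "'a::euclidean_space set \<Rightarrow> ('a \<Rightarrow> real) \<Rightarrow> bool" where
  "square_integrable S u \<longleftrightarrow> u \<in> borel_measurable (lebesgue_on S) \<and>
     integrable (lebesgue_on S) (\<lambda>x. (u x)\<^sup>2)"

text \<open>Functions are total and are not identified when they agree almost everywhere on \<open>S\<close>;
  all the notions below ignore null sets and values outside \<open>S\<close>.\<close>

definition has_weak_deriv ::
    "'a::euclidean_space set \<Rightarrow> 'a \<Rightarrow> ('a \<Rightarrow> real) \<Rightarrow> ('a \<Rightarrow> real) \<Rightarrow> bool" where
  "has_weak_deriv S b u g \<longleftrightarrow> square_integrable S u \<and> square_integrable S g \<and>
     (\<forall>\<phi>\<in>test_functions S.
        integral\<^sup>L (lebesgue_on S) (\<lambda>x. u x * frechet_derivative \<phi> (at x) b) =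
        - integral\<^sup>L (lebesgue_on S) (\<lambda>x. g x * \<phi> x))"

text \<open>A representative of the weak derivative, which for open \<open>S\<close> is unique up to null sets.\<close>

definition weak_deriv ::
    "'a::euclidean_space set \<Rightarrow> 'a \<Rightarrow> ('a \<Rightarrow> real) \<Rightarrow> 'a \<Rightarrow> real" where
  "weak_deriv S b u = (SOME g. has_weak_deriv S b u g)"

definition W12 :: "'a::euclidean_space set \<Rightarrow> ('a \<Rightarrow> real) set" where
  "W12 S = {u. square_integrable S u \<and> (\<forall>b\<in>Basis. \<exists>g. has_weak_deriv S b u g)}"

definition W12_norm :: "'a::euclidean_space set \<Rightarrow> ('a \<Rightarrow> real) \<Rightarrow> real" where
  "W12_norm S u = sqrt (integral\<^sup>L (lebesgue_on S) (\<lambda>x. (u x)\<^sup>2) +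
     (\<Sum>b\<in>Basis. integral\<^sup>L (lebesgue_on S) (\<lambda>x. (weak_deriv S b u x)\<^sup>2)))"

definition W12_0 :: "'a::euclidean_space set \<Rightarrow> ('a \<Rightarrow> real) set" where
  "W12_0 S = {u \<in> W12 S. \<exists>\<phi>. (\<forall>n::nat. \<phi> n \<in> test_functions S) \<and>
     (\<lambda>n. W12_norm S (\<lambda>x. \<phi> n x - u x)) \<longlonglongrightarrow> 0}"

text \<open>Boundary values of a Sobolev function, in the usual sense that \<open>u = g\<close> on the boundary
  means \<open>u - G \<in> W12_0 S\<close> for an extension \<open>G\<close> of \<open>g\<close> that lies in \<open>W12 S\<close> and is continuous
  up to the boundary.\<close>

definition has_boundary_values ::
    "'a::euclidean_space set \<Rightarrow> ('a \<Rightarrow> real) \<Rightarrow> ('a \<Rightarrow> real) \<Rightarrow> bool" where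
  "has_boundary_values S u g \<longleftrightarrow> (\<exists>G. G \<in> W12 S \<and> continuous_on (closure S) G \<and>
     (\<forall>x\<in>frontier S. G x = g x) \<and> (\<lambda>x. u x - G x) \<in> W12_0 S)"

abbreviation Dx :: "(real \<times> real) set \<Rightarrow> (real \<times> real \<Rightarrow> real) \<Rightarrow> real \<times> real \<Rightarrow> real" where
  "Dx S u \<equiv> weak_deriv S (1, 0) u"

abbreviation Dy :: "(real \<times> real) set \<Rightarrow> (real \<times> real \<Rightarrow> real) \<Rightarrow> real \<times> real \<Rightarrow> real" where
  "Dy S u \<equiv> weak_deriv S (0, 1) u"

definition Omega :: "real \<Rightarrow> (real \<times> real) set" where
  "Omega \<epsilon> = {(x, y). \<bar>x\<bar> < 1 \<and> \<bar>y\<bar> < 1 \<and> \<bar>x + y\<bar> < 2 - \<epsilon> \<and> \<bar>x - y\<bar> < 2 - \<epsilon>}"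

definition s_plus :: "real \<Rightarrow> real \<Rightarrow> real \<Rightarrow> real" where
  "s_plus A B C = (B + sqrt (B\<^sup>2 + 24 * \<bar>A\<bar> * C)) / (4 * C)"

text \<open>Only the values of \<open>q_b\<close> on the frontier of \<open>Omega \<epsilon>\<close> matter. There, the line equations
  below single out, in this order, the long edges \<open>C\<^sub>1 \<union> C\<^sub>3\<close> and \<open>C\<^sub>2 \<union> C\<^sub>4\<close> and the short edges
  \<open>S\<^sub>1\<close>, \<open>S\<^sub>2\<close>, \<open>S\<^sub>3\<close>, \<open>S\<^sub>4\<close>; the prescriptions agree at the common end points.\<close>

definition q_b :: "real \<Rightarrow> real \<Rightarrow> real \<times> real \<Rightarrow> real" where
  "q_b \<epsilon> s = (\<lambda>(x, y). let g = (\<lambda>l. s / (2 * \<epsilon>) * l) in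
     if \<bar>y\<bar> = 1 then s / 2
     else if \<bar>x\<bar> = 1 then - s / 2
     else if y - x = 2 - \<epsilon> then g (x + y)
     else if x + y = 2 - \<epsilon> then g (y - x)
     else if x - y = 2 - \<epsilon> then g (- x - y)
     else g (x - y))"

type_synonym field = "real \<times> real \<Rightarrow> real"

definition A_0 :: "real \<Rightarrow> real \<Rightarrow> real \<Rightarrow> real \<Rightarrow> (field \<times> field \<times> field) set" where
  "A_0 A B C \<epsilon> = {(q1, q2, q3).
     q1 \<in> W12 (Omega \<epsilon>) \<and> q2 \<in> W12 (Omega \<epsilon>) \<and> q3 \<in> W12 (Omega \<epsilon>) \<and>
     has_boundary_values (Omega \<epsilon>) q1 (q_b \<epsilon> (s_plus A B C)) \<and>
     has_boundary_values (Omega \<epsilon>) q2 (\<lambda>_. 0) \<and>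
     has_boundary_values (Omega \<epsilon>) q3 (\<lambda>_. - s_plus A B C / 6)}"

definition dirichlet :: "(real \<times> real) set \<Rightarrow> field \<Rightarrow> real" where
  "dirichlet S u = integral\<^sup>L (lebesgue_on S) (\<lambda>p. (Dx S u p)\<^sup>2 + (Dy S u p)\<^sup>2)"

text \<open>\<open>m1\<close>, \<open>m2\<close>, \<open>m3\<close> are the values of the given constants for the parameters \<open>A\<close>, \<open>B\<close>, \<open>C\<close>.\<close>

definition A_star :: "real \<Rightarrow> real \<Rightarrow> real \<Rightarrow> real \<Rightarrow> real \<Rightarrow> real \<Rightarrow> real \<Rightarrow>
    (field \<times> field \<times> field) set" where
  "A_star A B C \<epsilon> m1 m2 m3 = {(q1, q2, q3). (q1, q2, q3) \<in> A_0 A B C \<epsilon> \<and>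
     dirichlet (Omega \<epsilon>) q1 \<le> m1 \<and> dirichlet (Omega \<epsilon>) q2 \<le> m2 \<and> dirichlet (Omega \<epsilon>) q3 \<le> m3}"

definition f_el :: "real \<Rightarrow> real \<Rightarrow> real \<Rightarrow> real \<Rightarrow> real \<Rightarrow> real \<Rightarrow> real \<Rightarrow> real" where
  "f_el L2 q1x q1y q2x q2y q3x q3y =
     (1 + L2 / 2) * (q1x\<^sup>2 + q1y\<^sup>2) + (1 + L2 / 2) * (q2x\<^sup>2 + q2y\<^sup>2) + (3 + L2 / 2) * (q3x\<^sup>2 + q3y\<^sup>2)
     + L2 * (q1y * q3y - q1x * q3x - q2y * q3x - q2x * q3y)
     + \<bar>L2\<bar> * (q2y * q1x - q1y * q2x)"

definition f_b :: "real \<Rightarrow> real \<Rightarrow> real \<Rightarrow> real \<Rightarrow> real \<Rightarrow> real \<Rightarrow> real" where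
  "f_b A B C q1 q2 q3 =
     A * (q1\<^sup>2 + q2\<^sup>2 + 3 * q3\<^sup>2) + C * (q1\<^sup>2 + q2\<^sup>2 + 3 * q3\<^sup>2)\<^sup>2
     + 2 * B * q3 * (q1\<^sup>2 + q2\<^sup>2 - q3\<^sup>2)"

definition J :: "real \<Rightarrow> real \<Rightarrow> real \<Rightarrow> real \<Rightarrow> real \<Rightarrow> real \<Rightarrow> (real \<times> real) set \<Rightarrow>
    field \<Rightarrow> field \<Rightarrow> field \<Rightarrow> real" where
  "J A B C L lam L2 S q1 q2 q3 = integral\<^sup>L (lebesgue_on S) (\<lambda>p.
     f_el L2 (Dx S q1 p) (Dy S q1 p) (Dx S q2 p) (Dy S q2 p) (Dx S q3 p) (Dy S q3 p)
     + lam\<^sup>2 / L * f_b A B C (q1 p) (q2 p) (q3 p))"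

definition df_el :: "real \<Rightarrow> real \<Rightarrow> real \<Rightarrow> real \<Rightarrow> real \<Rightarrow> real \<Rightarrow> real \<Rightarrow>
    real \<Rightarrow> real \<Rightarrow> real \<Rightarrow> real \<Rightarrow> real \<Rightarrow> real \<Rightarrow> real" where
  "df_el L2 q1x q1y q2x q2y q3x q3y h1x h1y h2x h2y h3x h3y =
     (2 + L2) * (q1x * h1x + q1y * h1y) + (2 + L2) * (q2x * h2x + q2y * h2y)
     + (6 + L2) * (q3x * h3x + q3y * h3y)
     + L2 * (q3y * h1y - q3x * h1x - q3x * h2y - q3y * h2x
             + (q1y - q2x) * h3y - (q1x + q2y) * h3x)
     + \<bar>L2\<bar> * (q2y * h1x - q2x * h1y + q1x * h2y - q1y * h2x)"

definition df_b :: "real \<Rightarrow> real \<Rightarrow> real \<Rightarrow> real \<Rightarrow> real \<Rightarrow> real \<Rightarrow> real \<Rightarrow> real \<Rightarrow> real \<Rightarrow> real" where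
  "df_b A B C q1 q2 q3 h1 h2 h3 =
     (2 * A + 4 * C * (q1\<^sup>2 + q2\<^sup>2 + 3 * q3\<^sup>2)) * (q1 * h1 + q2 * h2 + 3 * q3 * h3)
     + 4 * B * q3 * (q1 * h1 + q2 * h2) + 2 * B * (q1\<^sup>2 + q2\<^sup>2 - 3 * q3\<^sup>2) * h3"

lemma df_el_is_derivative:
  "((\<lambda>t. f_el L2 (q1x + t * h1x) (q1y + t * h1y) (q2x + t * h2x) (q2y + t * h2y)
                 (q3x + t * h3x) (q3y + t * h3y))
    has_real_derivative df_el L2 q1x q1y q2x q2y q3x q3y h1x h1y h2x h2y h3x h3y) (at 0)"
  unfolding f_el_def df_el_def
  by (rule derivative_eq_intros refl | simp)+ (simp add: algebra_simps)

lemma df_b_is_derivative: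
  "((\<lambda>t. f_b A B C (q1 + t * h1) (q2 + t * h2) (q3 + t * h3))
    has_real_derivative df_b A B C q1 q2 q3 h1 h2 h3) (at 0)"
  unfolding f_b_def df_b_def
  by (rule derivative_eq_intros refl | simp)+ (simp add: algebra_simps power2_eq_square)

definition critical_point :: "real \<Rightarrow> real \<Rightarrow> real \<Rightarrow> real \<Rightarrow> real \<Rightarrow> real \<Rightarrow> real \<Rightarrow>
    field \<Rightarrow> field \<Rightarrow> field \<Rightarrow> bool" where
  "critical_point A B C L lam L2 \<epsilon> q1 q2 q3 \<longleftrightarrow> (q1, q2, q3) \<in> A_0 A B C \<epsilon> \<and>
     (let S = Omega \<epsilon> in \<forall>h1\<in>W12_0 S. \<forall>h2\<in>W12_0 S. \<forall>h3\<in>W12_0 S.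
        integral\<^sup>L (lebesgue_on S) (\<lambda>p.
          df_el L2 (Dx S q1 p) (Dy S q1 p) (Dx S q2 p) (Dy S q2 p) (Dx S q3 p) (Dy S q3 p)
                   (Dx S h1 p) (Dy S h1 p) (Dx S h2 p) (Dy S h2 p) (Dx S h3 p) (Dy S h3 p)
          + lam\<^sup>2 / L * df_b A B C (q1 p) (q2 p) (q3 p) (h1 p) (h2 p) (h3 p)) = 0)"

definition has_second_deriv_at_0 :: "(real \<Rightarrow> real) \<Rightarrow> real \<Rightarrow> bool" where
  "has_second_deriv_at_0 F d \<longleftrightarrow> (\<exists>F'.
     (\<forall>\<^sub>F t in nhds 0. (F has_real_derivative F' t) (at t)) \<and>
     (F' has_real_derivative d) (at 0))"

definition is_zero_on :: "(real \<times> real) set \<Rightarrow> field \<Rightarrow> bool" where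
  "is_zero_on S v \<longleftrightarrow> (AE p in lebesgue_on S. v p = 0)"

text \<open>The perturbations of the tensor along \<open>x \<otimes> x - y \<otimes> y\<close> and \<open>x \<otimes> y + y \<otimes> x\<close> change
  \<open>q\<^sub>1\<close> and \<open>q\<^sub>2\<close>, those along \<open>2 z \<otimes> z - x \<otimes> x - y \<otimes> y\<close> change \<open>q\<^sub>3\<close>.\<close>

definition stable_q1_q2 :: "real \<Rightarrow> real \<Rightarrow> real \<Rightarrow> real \<Rightarrow> real \<Rightarrow> real \<Rightarrow> (real \<times> real) set \<Rightarrow>
    field \<Rightarrow> field \<Rightarrow> field \<Rightarrow> bool" where
  "stable_q1_q2 A B C L lam L2 S q1 q2 q3 \<longleftrightarrow>
     (\<forall>v1\<in>W12_0 S. \<forall>v2\<in>W12_0 S. \<not> (is_zero_on S v1 \<and> is_zero_on S v2) \<longrightarrow>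
        (\<exists>d>0. has_second_deriv_at_0
           (\<lambda>t. J A B C L lam L2 S (\<lambda>p. q1 p + t * v1 p) (\<lambda>p. q2 p + t * v2 p) q3) d))"

definition stable_q3 :: "real \<Rightarrow> real \<Rightarrow> real \<Rightarrow> real \<Rightarrow> real \<Rightarrow> real \<Rightarrow> (real \<times> real) set \<Rightarrow>
    field \<Rightarrow> field \<Rightarrow> field \<Rightarrow> bool" where
  "stable_q3 A B C L lam L2 S q1 q2 q3 \<longleftrightarrow>
     (\<forall>v3\<in>W12_0 S. \<not> is_zero_on S v3 \<longrightarrow>
        (\<exists>d>0. has_second_deriv_at_0
           (\<lambda>t. J A B C L lam L2 S q1 q2 (\<lambda>p. q3 p + t * v3 p)) d))"

end

theory Submission
  imports Defs
begin

text \<open>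
  The bulk density \<open>f_b\<close> is a quartic polynomial with positive leading part, and along each of the
  two classes of perturbations its second derivative is bounded below, uniformly in \<open>q\<close>, by a
  negative multiple of \<open>\<bar>v\<bar>\<^sup>2\<close>: apart from a constant multiple of \<open>\<bar>v\<bar>\<^sup>2\<close>, the only term
  without a sign is linear in \<open>q3\<close>, and the positive term quadratic in \<open>q3\<close> absorbs it
  (\<open>d2f_b_12_lower_bound\<close>, \<open>d2f_b_3_lower_bound\<close>). The elastic part is already
  quadratic. For \<open>v3\<close> it gives \<open>(6 + L2) \<integral>\<bar>\<nabla>v3\<bar>\<^sup>2\<close>; for \<open>(v1, v2)\<close> it gives
  \<open>(2 + L2) \<integral>(\<bar>\<nabla>v1\<bar>\<^sup>2 + \<bar>\<nabla>v2\<bar>\<^sup>2)\<close> because the remaining term, a Jacobian determinant, is a null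
  Lagrangian and integrates to zero on \<open>W12_0\<close> (\<open>null_lagrangian_W12_0\<close>). Without this cancellation
  the coefficient of the gradient would stay bounded as \<open>L2\<close> grows. The Poincare inequality
  (\<open>poincare_W12_0\<close>), whose constant depends only on the width of the domain, then lets the elastic
  part dominate the bulk part as soon as \<open>L2 \<ge> lam\<^sup>2 / L * 4 * (6 \<bar>A\<bar> + B\<^sup>2 / (3 C))\<close>.

  Two analytic points remain. The weak derivative is a chosen representative, so the expansion of
  \<open>J\<close> along \<open>q + t v\<close> needs its uniqueness almost everywhere, that is, the fundamental lemma of the
  calculus of variations, and hence a supply of smooth bump functions. And integrating
  the expansion term by term needs the quartic terms to be integrable: Ladyzhenskaya's inequality in the
  plane puts \<open>W12_0\<close> into \<open>L\<^sup>4\<close>, and functions with continuous boundary values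
  differ from a bounded function by an element of \<open>W12_0\<close>. Then \<open>J\<close> is a polynomial of degree four
  in \<open>t\<close> and its second derivative is the integral of \<open>second_variation\<close>.
\<close>

section \<open>Smooth functions and bump functions\<close>

lemma Ck_Suc_has_derivative:
  "Ck (Suc k) f \<Longrightarrow> (f has_derivative frechet_derivative f (at x)) (at x)"
  using frechet_derivative_works by auto

lemma Ck_Suc_imp_Ck: "Ck (Suc k) f \<Longrightarrow> Ck k f"
proof (induction k arbitrary: f)
  case 0
  then show ?case
    by (auto simp: continuous_on_eq_continuous_at differentiable_imp_continuous_within)
next
  case (Suc k)
  then show ?case by simp
qed

lemma Ck_SucI:
  assumes "\<And>x. (f has_derivative f' x) (at x)" and "\<And>b. b \<in> Basis \<Longrightarrow> Ck k (\<lambda>x. f' x b)"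
  shows "Ck (Suc k) f"
proof -
  have "frechet_derivative f (at x) = f' x" for x
    using frechet_derivative_at[OF assms(1)] by simp
  then show ?thesis
    using assms by (auto simp: differentiable_def)
qed

lemma Ck_const: "Ck k (\<lambda>x. c)"
proof (induction k arbitrary: c)
  case (Suc k)
  then show ?case by (intro Ck_SucI[where f' = "\<lambda>x h. 0"]) auto
qed simp

lemma Ck_add: "Ck k f \<Longrightarrow> Ck k g \<Longrightarrow> Ck k (\<lambda>x. f x + g x)"
proof (induction k arbitrary: f g)
  case 0
  then show ?case by (auto intro: continuous_intros)
next
  case (Suc k)
  note [derivative_intros] = Ck_Suc_has_derivative[OF Suc.prems(1)] Ck_Suc_has_derivative[OF Suc.prems(2)]
  show ?case
    by (rule Ck_SucI, (rule derivative_intros)+) (use Suc in auto)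
qed

lemma Ck_mult: "Ck k f \<Longrightarrow> Ck k g \<Longrightarrow> Ck k (\<lambda>x. f x * g x)"
proof (induction k arbitrary: f g)
  case 0
  then show ?case by (auto intro: continuous_intros)
next
  case (Suc k)
  note [derivative_intros] = Ck_Suc_has_derivative[OF Suc.prems(1)] Ck_Suc_has_derivative[OF Suc.prems(2)]
  have "Ck k f" "Ck k g"
    using Suc.prems Ck_Suc_imp_Ck by blast+
  note Ck_lower = this
  show ?case
    by (rule Ck_SucI, (rule derivative_intros)+) (use Suc Ck_lower in \<open>auto intro!: Ck_add\<close>)
qed

lemma Ck_prod:
  assumes "finite I" and "\<And>i. i \<in> I \<Longrightarrow> Ck k (f i)"
  shows "Ck k (\<lambda>x. \<Prod>i\<in>I. f i x)"
  using assms by (induction I) (auto intro: Ck_const Ck_mult)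

text \<open>
  The factor \<open>x\<^sup>-\<^sup>m\<close> makes this family closed, up to linear combinations, under
  differentiation; smoothness of \<open>flat_exp 0\<close> then follows by an induction that treats all \<open>m\<close> at once.
\<close>

definition flat_exp :: "nat \<Rightarrow> real \<Rightarrow> real" where
  "flat_exp m x = (if x \<le> 0 then 0 else exp (- inverse x) * inverse x ^ m)"

text \<open>
  With \<open>s = 1 / x\<close> this is the decay of \<open>s ^ m * exp (- s)\<close> at infinity.
\<close>

lemma tendsto_flat_exp_0: "(flat_exp m \<longlongrightarrow> 0) (at 0)"
proof -
  have "((\<lambda>s::real. s ^ m / exp s) \<longlongrightarrow> 0) at_top"
    by (rule tendsto_power_div_exp_0)
  then have "((\<lambda>x::real. inverse x ^ m / exp (inverse x)) \<longlongrightarrow> 0) (at_right 0)"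
    by (rule filterlim_compose[OF _ filterlim_inverse_at_top_right])
  then have "(flat_exp m \<longlongrightarrow> 0) (at_right 0)"
    by (rule Lim_transform_eventually)
       (auto simp: eventually_at_right_field flat_exp_def exp_minus field_simps intro: exI[of _ 1])
  moreover have "((\<lambda>x. 0) \<longlongrightarrow> (0::real)) (at_left 0)"
    by simp
  then have "(flat_exp m \<longlongrightarrow> 0) (at_left 0)"
    by (rule Lim_transform_eventually)
       (auto simp: eventually_at_left_field flat_exp_def intro: exI[of _ "-1"])
  ultimately show ?thesis
    by (simp add: filterlim_split_at)
qed

text \<open>
  Only \<open>x = 0\<close> is not a computation: there the difference quotient of \<open>flat_exp m\<close> is
  \<open>flat_exp (m + 1)\<close>, which tends to \<open>0\<close>.
\<close>

lemma flat_exp_has_derivative: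
  "(flat_exp m has_real_derivative flat_exp (m + 2) x - real m * flat_exp (m + 1) x) (at x)"
proof -
  consider "x < 0" | "x = 0" | "x > 0" by linarith
  then show ?thesis
  proof cases
    case 1
    have "((\<lambda>x. 0) has_real_derivative 0) (at x)" by simp
    then show ?thesis
      using 1 by (rule_tac has_field_derivative_transform_within_open[where S = "{..<0}"])
        (auto simp: flat_exp_def)
  next
    case 2
    have "(\<lambda>h. (flat_exp m (0 + h) - flat_exp m 0) / h) = flat_exp (m + 1)"
      by (auto simp: flat_exp_def fun_eq_iff field_simps)
    then show ?thesis
      using tendsto_flat_exp_0[of "m + 1"] 2
      by (simp add: DERIV_def) (simp add: flat_exp_def)
  next
    case 3
    have "((\<lambda>x. exp (- inverse x) * inverse x ^ m) has_real_derivative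
        flat_exp (m + 2) x - real m * flat_exp (m + 1) x) (at x)"
      by (intro DERIV_cong[OF DERIV_mult[OF DERIV_fun_exp[OF DERIV_minus[OF DERIV_inverse]]
            DERIV_power[OF DERIV_inverse]]])
         (use 3 in \<open>cases m; simp add: flat_exp_def field_simps power2_eq_square\<close>)+
    then show ?thesis
      using 3 by (rule_tac has_field_derivative_transform_within_open[where S = "{0<..}"])
        (auto simp: flat_exp_def)
  qed
qed

lemma Ck_flat_exp_affine:
  fixes a :: "'a::euclidean_space"
  shows "Ck k (\<lambda>z. flat_exp m (a \<bullet> z + \<beta>))"
proof (induction k arbitrary: m)
  case 0
  have "continuous_on UNIV (flat_exp m)"
    using flat_exp_has_derivative DERIV_isCont continuous_at_imp_continuous_on by blast
  then show ?case
    by (auto intro!: continuous_on_compose2[of UNIV "flat_exp m"] continuous_intros)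
next
  case (Suc k)
  let ?d = "\<lambda>z. flat_exp (m + 2) (a \<bullet> z + \<beta>) + (- real m) * flat_exp (m + 1) (a \<bullet> z + \<beta>)"
  have "((\<lambda>z. flat_exp m (a \<bullet> z + \<beta>)) has_derivative (\<lambda>h. (a \<bullet> h) * ?d z)) (at z)" for z
    by (rule DERIV_compose_FDERIV[OF flat_exp_has_derivative, THEN has_derivative_eq_rhs])
       (auto intro!: derivative_eq_intros)
  moreover have "Ck k (\<lambda>z. (a \<bullet> b) * ?d z)" for b
    by (intro Ck_mult Ck_add Ck_const Suc.IH)
  ultimately show ?case
    by (intro Ck_SucI)
qed

text \<open>
  Increasing \<open>n\<close> stretches the argument of \<open>exp (- 1 / x)\<close>, so that the profile flattens to \<open>1\<close>
  inside the box while it keeps vanishing outside.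
\<close>

definition box_bump :: "'a::euclidean_space \<Rightarrow> 'a \<Rightarrow> nat \<Rightarrow> 'a \<Rightarrow> real" where
  "box_bump a b n z =
     (\<Prod>i\<in>Basis. flat_exp 0 (real (Suc n) * (z \<bullet> i - a \<bullet> i)) * flat_exp 0 (real (Suc n) * (b \<bullet> i - z \<bullet> i)))"

lemma flat_exp_0_bounds: "0 \<le> flat_exp 0 x" "flat_exp 0 x \<le> 1"
  by (auto simp: flat_exp_def)

lemma box_bump_bounds: "0 \<le> box_bump a b n z" "box_bump a b n z \<le> 1"
  unfolding box_bump_def
  by (auto intro!: prod_nonneg prod_le_1 mult_nonneg_nonneg mult_le_one flat_exp_0_bounds)

lemma box_bump_outside: "z \<notin> box a b \<Longrightarrow> box_bump a b n z = 0"
  by (auto simp: box_bump_def mem_box flat_exp_def not_less mult_le_0_iff)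

lemma box_bump_test_function:
  assumes "cbox a b \<subseteq> S"
  shows "box_bump a b n \<in> test_functions S"
proof -
  have "Ck k (\<lambda>z. flat_exp 0 (real (Suc n) * (z \<bullet> i - a \<bullet> i)))" for k and i
    using Ck_flat_exp_affine[of k 0 "real (Suc n) *\<^sub>R i" "- real (Suc n) * (a \<bullet> i)"]
    by (simp add: algebra_simps inner_commute)
  moreover have "Ck k (\<lambda>z. flat_exp 0 (real (Suc n) * (b \<bullet> i - z \<bullet> i)))" for k and i
    using Ck_flat_exp_affine[of k 0 "- real (Suc n) *\<^sub>R i" "real (Suc n) * (b \<bullet> i)"]
    by (simp add: algebra_simps inner_commute)
  ultimately have "Ck k (box_bump a b n)" for k
    unfolding box_bump_def by (intro Ck_prod Ck_mult) auto
  moreover have "closure {z. box_bump a b n z \<noteq> 0} \<subseteq> cbox a b"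
    using box_bump_outside[of _ a b n] box_subset_cbox[of a b]
    by (intro closure_minimal) blast+
  moreover from this have "compact (closure {z. box_bump a b n z \<noteq> 0})"
    using compact_Int_closed[OF compact_cbox closed_closure, of a b] by (metis inf_absorb2)
  ultimately show ?thesis
    using assms by (auto simp: test_functions_def)
qed

lemma box_bump_tendsto:
  fixes z :: "'a::euclidean_space"
  shows "(\<lambda>n. box_bump a b n z) \<longlonglongrightarrow> indicator (box a b) z"
proof (cases "z \<in> box a b")
  case True
  have 1: "(\<lambda>n. flat_exp 0 (real (Suc n) * u)) \<longlonglongrightarrow> 1" if "u > 0" for u
  proof -
    have "(\<lambda>n. exp (- (inverse (real (Suc n)) * inverse u))) \<longlonglongrightarrow> exp (- (0 * inverse u))"
      by (intro tendsto_intros LIMSEQ_inverse_real_of_nat)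
    then show ?thesis
      using that by (simp add: flat_exp_def mult_le_0_iff)
  qed
  have "(\<lambda>n. box_bump a b n z) \<longlonglongrightarrow> (\<Prod>i\<in>(Basis :: 'a set). 1 * 1)"
    unfolding box_bump_def by (intro Limits.tendsto_prod tendsto_mult 1) (use True in \<open>auto simp: mem_box\<close>)
  then show ?thesis
    using True by simp
qed (simp add: box_bump_outside)

section \<open>Integrals of derivatives and symmetry of second derivatives\<close>

lemma integrable_lborel_continuous_compact_support:
  fixes f :: "'a::euclidean_space \<Rightarrow> real"
  assumes "continuous_on UNIV f" "compact K" "\<And>x. x \<notin> K \<Longrightarrow> f x = 0"
  shows "integrable lborel f"
proof -
  have "integrable lborel (\<lambda>x. indicator K x *\<^sub>R f x)"
    by (rule borel_integrable_compact) (use assms continuous_on_subset[OF assms(1)] in auto)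
  also have "(\<lambda>x. indicator K x *\<^sub>R f x) = f"
    using assms(3) by (auto simp: indicator_def fun_eq_iff)
  finally show ?thesis .
qed

lemma bounded_continuous_compact_support:
  fixes f :: "'a::euclidean_space \<Rightarrow> real"
  assumes "continuous_on UNIV f" "compact K" "\<And>x. x \<notin> K \<Longrightarrow> f x = 0"
  obtains M where "M \<ge> 0" "\<And>x. \<bar>f x\<bar> \<le> M"
proof -
  have "bounded (f ` K)"
    using assms by (meson compact_continuous_image compact_imp_bounded continuous_on_subset subset_UNIV)
  then obtain M where M: "\<And>x. x \<in> K \<Longrightarrow> \<bar>f x\<bar> \<le> M"
    by (auto simp: bounded_iff)
  show thesis
  proof (rule that[of "max M 0"])
    show "\<bar>f x\<bar> \<le> max M 0" for x
      using M[of x] assms(3)[of x] by (cases "x \<in> K") auto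
  qed simp
qed

lemma lborel_integral_translate:
  fixes f :: "'a::euclidean_space \<Rightarrow> real"
  assumes [measurable]: "f \<in> borel_measurable borel"
  shows "integral\<^sup>L lborel (\<lambda>x. f (x + c)) = integral\<^sup>L lborel f"
proof -
  have "integral\<^sup>L lborel f = integral\<^sup>L (distr lborel borel ((+) c)) f"
    by (simp add: lborel_distr_plus)
  also have "\<dots> = integral\<^sup>L lborel (\<lambda>x. f (c + x))"
    by (rule integral_distr) auto
  finally show ?thesis
    by (simp add: add.commute)
qed

lemma lborel_integrable_translate:
  fixes f :: "'a::euclidean_space \<Rightarrow> real"
  assumes "integrable lborel f"
  shows "integrable lborel (\<lambda>x. f (x + c))"
proof -
  have "integrable (distr lborel borel ((+) c)) f"
    using assms by (simp add: lborel_distr_plus)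
  then show ?thesis
    by (subst (asm) integrable_distr_eq) (use assms in \<open>auto simp: add.commute\<close>)
qed

lemma has_real_derivative_along_line:
  fixes f :: "'a::real_normed_vector \<Rightarrow> real"
  assumes "(f has_derivative f') (at (x + t *\<^sub>R b))"
  shows "((\<lambda>s. f (x + s *\<^sub>R b)) has_real_derivative f' b) (at t)"
proof -
  have "((\<lambda>s. x + s *\<^sub>R b) has_derivative (\<lambda>s. s *\<^sub>R b)) (at t)"
    by (auto intro!: derivative_eq_intros)
  from has_derivative_compose[OF this assms] show ?thesis
    using linear_scale[OF has_derivative_linear[OF assms]]
    by (simp add: has_field_derivative_def mult_commute_abs)
qed

lemma directional_derivative_outside_support:
  fixes f :: "'a::euclidean_space \<Rightarrow> real"
  assumes "(f has_derivative f') (at x)" "compact K" "\<And>x. x \<notin> K \<Longrightarrow> f x = 0" "x \<notin> K"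
  shows "f' b = 0"
proof -
  have "open (- K)"
    using assms by (simp add: compact_imp_closed open_Compl)
  then have "(f has_derivative (\<lambda>_. 0)) (at x)"
    using assms by (auto intro: has_derivative_transform_within_open[OF has_derivative_const])
  then show ?thesis
    using has_derivative_unique[OF assms(1)] by metis
qed

text \<open>
  The difference quotients of \<open>f\<close> in direction \<open>b\<close> have integral zero because Lebesgue measure is
  translation invariant, and they converge to the directional derivative. The mean value theorem
  bounds them, and step lengths at most \<open>1\<close> keep their supports in a fixed ball, so dominated
  convergence applies.
\<close>

lemma integral_directional_derivative_eq_0:
  fixes f :: "'a::euclidean_space \<Rightarrow> real"
  assumes f': "\<And>x. (f has_derivative f' x) (at x)"
    and cont: "continuous_on UNIV (\<lambda>x. f' x b)"
    and K: "compact K" "\<And>x. x \<notin> K \<Longrightarrow> f x = 0"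
  shows "integral\<^sup>L lborel (\<lambda>x. f' x b) = 0"
proof -
  have f'0: "f' x b = 0" if "x \<notin> K" for x
    using directional_derivative_outside_support[OF f' K that] .
  obtain M where M: "M \<ge> 0" "\<And>x. \<bar>f' x b\<bar> \<le> M"
    using bounded_continuous_compact_support[OF cont K(1) f'0] by auto
  have f_cont: "continuous_on UNIV f"
    using f' has_derivative_continuous continuous_at_imp_continuous_on by blast
  then have [measurable]: "f \<in> borel_measurable borel"
    by (rule borel_measurable_continuous_onI)
  have f_int: "integrable lborel f"
    using integrable_lborel_continuous_compact_support[OF f_cont K] .
  obtain r where r: "K \<subseteq> cball 0 r"
    using compact_imp_bounded[OF K(1)] bounded_subset_ballD[of K 0] ball_subset_cball by (metis order_trans)
  define h where "h n = inverse (real (Suc n))" for n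
  have h: "h n > 0" "h n \<le> 1" for n
    by (auto simp: h_def field_simps)
  define q where "q n x = (f (x + h n *\<^sub>R b) - f x) / h n" for n x
  have "integral\<^sup>L lborel (q n) = 0" for n
    unfolding q_def
    using f_int lborel_integrable_translate[OF f_int, of "h n *\<^sub>R b"]
    by (simp add: lborel_integral_translate)
  moreover have "(\<lambda>n. integral\<^sup>L lborel (q n)) \<longlonglongrightarrow> integral\<^sup>L lborel (\<lambda>x. f' x b)"
  proof (rule integral_dominated_convergence[where w = "\<lambda>x. indicator (cball 0 (r + norm b)) x *\<^sub>R M"])
    show "(\<lambda>x. f' x b) \<in> borel_measurable lborel"
      using borel_measurable_continuous_onI[OF cont] by simp
    show "q n \<in> borel_measurable lborel" for n
      unfolding q_def by measurable
    show "integrable lborel (\<lambda>x::'a. indicator (cball 0 (r + norm b)) x *\<^sub>R M)"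
      by (rule borel_integrable_compact) auto
    show "AE x in lborel. (\<lambda>n. q n x) \<longlonglongrightarrow> f' x b"
    proof (rule AE_I2)
      fix x :: 'a
      have "((\<lambda>s. f (x + s *\<^sub>R b)) has_real_derivative f' x b) (at 0)"
        by (rule has_real_derivative_along_line) (use f' in simp)
      then have "((\<lambda>t. (f (x + t *\<^sub>R b) - f x) / t) \<longlongrightarrow> f' x b) (at 0)"
        by (simp add: DERIV_def)
      moreover have "filterlim h (at 0) sequentially"
        using h LIMSEQ_inverse_real_of_nat
        by (auto simp: filterlim_at h_def[abs_def] intro!: always_eventually)
      ultimately show "(\<lambda>n. q n x) \<longlonglongrightarrow> f' x b"
        unfolding q_def by (rule filterlim_compose)
    qed
    show "AE x in lborel. norm (q n x) \<le> indicator (cball 0 (r + norm b)) x *\<^sub>R M" for n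
    proof (rule AE_I2)
      fix x :: 'a
      show "norm (q n x) \<le> indicator (cball 0 (r + norm b)) x *\<^sub>R M"
      proof (cases "x \<in> cball 0 (r + norm b)")
        case True
        have "\<exists>\<xi>>0. \<xi> < h n \<and> f (x + h n *\<^sub>R b) - f (x + 0 *\<^sub>R b) = (h n - 0) * f' (x + \<xi> *\<^sub>R b) b"
          using h(1)[of n]
          by (intro MVT2 has_real_derivative_along_line[OF f'])
        then obtain \<xi> where "f (x + h n *\<^sub>R b) - f x = h n * f' (x + \<xi> *\<^sub>R b) b"
          by auto
        then have "q n x = f' (x + \<xi> *\<^sub>R b) b"
          using h(1)[of n] by (simp add: q_def)
        then show ?thesis
          using M(2) True by simp
      next
        case False
        have "norm (h n *\<^sub>R b) \<le> norm b"
          using h[of n] by (simp add: mult_left_le_one_le)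
        then have "norm (x + h n *\<^sub>R b) > r"
          using False norm_triangle_ineq4[of "x + h n *\<^sub>R b" "h n *\<^sub>R b"] by simp
        moreover have "norm x > r"
          using False norm_ge_zero[of b] unfolding mem_cball_0 by linarith
        ultimately have "x \<notin> K" "x + h n *\<^sub>R b \<notin> K"
          using r by (auto simp: subset_iff)
        then show ?thesis
          using K(2) False by (simp add: q_def)
      qed
    qed
  qed
  ultimately show ?thesis
    by (simp add: LIMSEQ_const_iff)
qed

text \<open>
  Two applications of the mean value theorem turn the second difference into \<open>h\<^sup>2\<close> times a second
  derivative at an intermediate point. The second difference is symmetric in \<open>b\<close> and \<open>c\<close>, so its
  limit yields the symmetry of second derivatives.
\<close>

lemma second_difference_quotient_tendsto:
  fixes f :: "'a::euclidean_space \<Rightarrow> real"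
  assumes f': "\<And>x. (f has_derivative f' x) (at x)"
    and f'': "\<And>x. ((\<lambda>x. f' x b) has_derivative f'' x) (at x)"
    and cont: "continuous_on UNIV (\<lambda>x. f'' x c)"
  shows "((\<lambda>h. (f (x + h *\<^sub>R b + h *\<^sub>R c) - f (x + h *\<^sub>R b) - f (x + h *\<^sub>R c) + f x) / h\<^sup>2)
    \<longlongrightarrow> f'' x c) (at_right 0)"
proof (rule tendstoI)
  fix e :: real assume "e > 0"
  have "isCont (\<lambda>x. f'' x c) x"
    using cont by (simp add: continuous_on_eq_continuous_at)
  then obtain d where d: "d > 0" "\<And>y. norm (y - x) < d \<Longrightarrow> \<bar>f'' y c - f'' x c\<bar> < e"
    using \<open>e > 0\<close> unfolding continuous_at_eps_delta dist_norm by (metis real_norm_def)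
  \<comment> \<open>The intermediate point then differs from \<open>x\<close> by less than \<open>d\<close>.\<close>
  define d' where "d' = d / (1 + norm b + norm c)"
  have den: "1 + norm b + norm c > 0"
    by (simp add: add_pos_nonneg)
  have "d' > 0"
    using d den by (simp add: d'_def)
  moreover have "dist ((f (x + h *\<^sub>R b + h *\<^sub>R c) - f (x + h *\<^sub>R b) - f (x + h *\<^sub>R c) + f x) / h\<^sup>2) (f'' x c) < e"
    if h: "0 < h" "h < d'" for h
  proof -
    let ?g = "\<lambda>s. f (x + h *\<^sub>R c + s *\<^sub>R b) - f (x + s *\<^sub>R b)"
    have "\<exists>\<xi>>0. \<xi> < h \<and> ?g h - ?g 0 = (h - 0) * (f' (x + h *\<^sub>R c + \<xi> *\<^sub>R b) b - f' (x + \<xi> *\<^sub>R b) b)"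
      using h(1) by (intro MVT2 DERIV_diff has_real_derivative_along_line[OF f'])
    then obtain \<xi> where \<xi>: "0 < \<xi>" "\<xi> < h"
      "?g h - ?g 0 = h * (f' (x + h *\<^sub>R c + \<xi> *\<^sub>R b) b - f' (x + \<xi> *\<^sub>R b) b)"
      by auto
    have "\<exists>\<eta>>0. \<eta> < h \<and> f' (x + \<xi> *\<^sub>R b + h *\<^sub>R c) b - f' (x + \<xi> *\<^sub>R b + 0 *\<^sub>R c) b
        = (h - 0) * f'' (x + \<xi> *\<^sub>R b + \<eta> *\<^sub>R c) c"
      using h(1) by (intro MVT2 has_real_derivative_along_line[OF f''])
    then obtain \<eta> where \<eta>: "0 < \<eta>" "\<eta> < h"
      "f' (x + \<xi> *\<^sub>R b + h *\<^sub>R c) b - f' (x + \<xi> *\<^sub>R b) b = h * f'' (x + \<xi> *\<^sub>R b + \<eta> *\<^sub>R c) c"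
      by auto
    have "f (x + h *\<^sub>R b + h *\<^sub>R c) - f (x + h *\<^sub>R b) - f (x + h *\<^sub>R c) + f x = ?g h - ?g 0"
      by (simp add: algebra_simps)
    also have "\<dots> = h * (h * f'' (x + \<xi> *\<^sub>R b + \<eta> *\<^sub>R c) c)"
      unfolding \<xi>(3) \<eta>(3)[symmetric] by (simp add: algebra_simps)
    finally have eq: "(f (x + h *\<^sub>R b + h *\<^sub>R c) - f (x + h *\<^sub>R b) - f (x + h *\<^sub>R c) + f x) / h\<^sup>2
        = f'' (x + \<xi> *\<^sub>R b + \<eta> *\<^sub>R c) c"
      using h(1) by (simp add: power2_eq_square)
    have "norm (\<xi> *\<^sub>R b + \<eta> *\<^sub>R c) \<le> \<xi> * norm b + \<eta> * norm c"
      using norm_triangle_ineq[of "\<xi> *\<^sub>R b" "\<eta> *\<^sub>R c"] \<xi> \<eta> by simp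
    also have "\<dots> \<le> h * norm b + h * norm c"
      using \<xi> \<eta> by (intro add_mono mult_right_mono) auto
    also have "\<dots> \<le> h * (1 + norm b + norm c)"
      using h by (simp add: algebra_simps)
    also have "\<dots> < d"
      using h(2) den by (simp add: d'_def field_simps)
    finally have "norm (x + \<xi> *\<^sub>R b + \<eta> *\<^sub>R c - x) < d"
      by (simp add: algebra_simps)
    then show ?thesis
      unfolding eq dist_real_def using d(2) by blast
  qed
  ultimately show "\<forall>\<^sub>F h in at_right 0.
    dist ((f (x + h *\<^sub>R b + h *\<^sub>R c) - f (x + h *\<^sub>R b) - f (x + h *\<^sub>R c) + f x) / h\<^sup>2) (f'' x c) < e"
    unfolding eventually_at_right_field by blast
qed

text \<open>
  Directional derivatives as an operator on functions, so that they can be iterated.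
\<close>

definition pdiff :: "'a::euclidean_space \<Rightarrow> ('a \<Rightarrow> real) \<Rightarrow> 'a \<Rightarrow> real" where
  "pdiff b f x = frechet_derivative f (at x) b"

lemma pdiff_commute:
  assumes "Ck 2 f" "b \<in> Basis" "c \<in> Basis"
  shows "pdiff b (pdiff c f) x = pdiff c (pdiff b f) x"
proof -
  have C2: "Ck (Suc (Suc 0)) f"
    using assms(1) by (simp add: numeral_2_eq_2)
  have lim: "((\<lambda>h. (f (x + h *\<^sub>R b + h *\<^sub>R c) - f (x + h *\<^sub>R b) - f (x + h *\<^sub>R c) + f x) / h\<^sup>2)
      \<longlongrightarrow> pdiff c (pdiff b f) x) (at_right 0)" if "b \<in> Basis" "c \<in> Basis" for b c
  proof -
    have 1: "Ck (Suc 0) (pdiff b f)"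
      using C2 that by (simp add: pdiff_def[abs_def])
    show ?thesis
      unfolding pdiff_def[of c]
      by (rule second_difference_quotient_tendsto[OF Ck_Suc_has_derivative[OF C2]])
         (use 1 that Ck_Suc_has_derivative[OF 1] in \<open>simp_all add: pdiff_def[abs_def]\<close>)
  qed
  have "((\<lambda>h. (f (x + h *\<^sub>R b + h *\<^sub>R c) - f (x + h *\<^sub>R b) - f (x + h *\<^sub>R c) + f x) / h\<^sup>2)
      \<longlongrightarrow> pdiff b (pdiff c f) x) (at_right 0)"
    using lim[OF assms(3,2)] by (simp add: algebra_simps)
  then show ?thesis
    using tendsto_unique[OF trivial_limit_at_right_real _ lim[OF assms(2,3)]] by blast
qed

section \<open>Test functions\<close>

lemma test_function_Ck: "\<phi> \<in> test_functions S \<Longrightarrow> Ck k \<phi>"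
  by (simp add: test_functions_def)

lemma test_function_continuous: "\<phi> \<in> test_functions S \<Longrightarrow> continuous_on UNIV \<phi>"
  using test_function_Ck[of \<phi> S 0] by simp

lemma test_function_has_derivative:
  "\<phi> \<in> test_functions S \<Longrightarrow> (\<phi> has_derivative frechet_derivative \<phi> (at x)) (at x)"
  by (rule Ck_Suc_has_derivative[OF test_function_Ck])

lemma test_function_support:
  assumes "\<phi> \<in> test_functions S"
  obtains K where "compact K" "K \<subseteq> S" "\<And>x. x \<notin> K \<Longrightarrow> \<phi> x = 0"
  using assms closure_subset[of "{x. \<phi> x \<noteq> 0}"] unfolding test_functions_def by blast

lemma test_functionI:
  assumes "\<And>k. Ck k \<phi>" "compact K" "K \<subseteq> S" "\<And>x. x \<notin> K \<Longrightarrow> \<phi> x = 0"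
  shows "\<phi> \<in> test_functions S"
proof -
  have "closure {x. \<phi> x \<noteq> 0} \<subseteq> K"
    using assms by (intro closure_minimal compact_imp_closed) auto
  moreover from this have "compact (closure {x. \<phi> x \<noteq> 0})"
    using compact_Int_closed[OF assms(2) closed_closure] by (metis inf_absorb2)
  ultimately show ?thesis
    using assms by (auto simp: test_functions_def)
qed

lemma pdiff_test_function:
  assumes "\<phi> \<in> test_functions S" "b \<in> Basis"
  shows "pdiff b \<phi> \<in> test_functions S"
proof -
  obtain K where K: "compact K" "K \<subseteq> S" "\<And>x. x \<notin> K \<Longrightarrow> \<phi> x = 0"
    using test_function_support[OF assms(1)] by blast
  show ?thesis
  proof (rule test_functionI[OF _ K(1,2)])
    show "Ck k (pdiff b \<phi>)" for k
      using test_function_Ck[OF assms(1), of "Suc k"] assms(2) by (simp add: pdiff_def[abs_def])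
    show "pdiff b \<phi> x = 0" if "x \<notin> K" for x
      unfolding pdiff_def
      using directional_derivative_outside_support[OF test_function_has_derivative[OF assms(1)] K(1,3) that] .
  qed
qed

lemma zero_test_function: "(\<lambda>x. 0) \<in> test_functions S"
  by (rule test_functionI[of _ "{}"]) (auto intro: Ck_const)

text \<open>
  The two integrands add up to the derivative of \<open>\<phi> \<psi>\<close>, which has compact support.
\<close>

lemma integral_by_parts_test_function:
  assumes "\<phi> \<in> test_functions S" "\<psi> \<in> test_functions S" "b \<in> Basis"
  shows "integral\<^sup>L lborel (\<lambda>x. \<phi> x * pdiff b \<psi> x) = - integral\<^sup>L lborel (\<lambda>x. pdiff b \<phi> x * \<psi> x)"
proof -
  obtain K where K: "compact K" "K \<subseteq> S" "\<And>x. x \<notin> K \<Longrightarrow> \<phi> x = 0"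
    using test_function_support[OF assms(1)] by blast
  have cont: "continuous_on UNIV \<phi>" "continuous_on UNIV \<psi>"
      "continuous_on UNIV (pdiff b \<phi>)" "continuous_on UNIV (pdiff b \<psi>)"
    using assms by (intro test_function_continuous[of _ S] pdiff_test_function; simp)+
  have 0: "pdiff b \<phi> x = 0" if "x \<notin> K" for x
    unfolding pdiff_def
    using directional_derivative_outside_support[OF test_function_has_derivative[OF assms(1)] K(1,3) that] .
  have "integral\<^sup>L lborel (\<lambda>x. \<phi> x * frechet_derivative \<psi> (at x) b + frechet_derivative \<phi> (at x) b * \<psi> x) = 0"
  proof (rule integral_directional_derivative_eq_0[where f = "\<lambda>x. \<phi> x * \<psi> x" and K = K])
    show "((\<lambda>x. \<phi> x * \<psi> x) has_derivative
        (\<lambda>b. \<phi> x * frechet_derivative \<psi> (at x) b + frechet_derivative \<phi> (at x) b * \<psi> x)) (at x)" for x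
      using assms by (intro has_derivative_mult test_function_has_derivative)
    show "continuous_on UNIV (\<lambda>x. \<phi> x * frechet_derivative \<psi> (at x) b + frechet_derivative \<phi> (at x) b * \<psi> x)"
      using cont unfolding pdiff_def[abs_def] by (intro continuous_intros)
  qed (use K in auto)
  moreover have "integrable lborel (\<lambda>x. \<phi> x * pdiff b \<psi> x)"
    using cont K by (intro integrable_lborel_continuous_compact_support[where K = K] continuous_intros) auto
  moreover have "integrable lborel (\<lambda>x. pdiff b \<phi> x * \<psi> x)"
    using cont K 0 by (intro integrable_lborel_continuous_compact_support[where K = K] continuous_intros) auto
  ultimately show ?thesis
    by (simp add: pdiff_def)
qed

section \<open>Square integrable functions\<close>

lemma borel_measurable_lebesgue_on: "f \<in> borel_measurable borel \<Longrightarrow> f \<in> borel_measurable (lebesgue_on S)"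
  by (simp add: measurable_completion measurable_restrict_space1)

lemma integral_lebesgue_on_eq_lborel:
  fixes f :: "'a::euclidean_space \<Rightarrow> real"
  assumes "f \<in> borel_measurable borel" "S \<in> sets borel" "\<And>x. x \<notin> S \<Longrightarrow> f x = 0"
  shows "integral\<^sup>L (lebesgue_on S) f = integral\<^sup>L lborel f"
    and "integrable (lebesgue_on S) f \<longleftrightarrow> integrable lborel f"
proof -
  have "(\<lambda>x. indicator S x *\<^sub>R f x) = f"
    using assms(3) by (auto simp: indicator_def fun_eq_iff)
  moreover have "S \<in> sets lebesgue"
    using assms(2) by simp
  ultimately show "integral\<^sup>L (lebesgue_on S) f = integral\<^sup>L lborel f"
    and "integrable (lebesgue_on S) f \<longleftrightarrow> integrable lborel f"
    using assms(1)
    by (simp_all add: integral_restrict_space integrable_restrict_space integral_completion integrable_completion)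
qed

lemma square_integrable_mult_integrable:
  assumes "square_integrable S u" "square_integrable S v"
  shows "integrable (lebesgue_on S) (\<lambda>x. u x * v x)"
proof (rule Bochner_Integration.integrable_bound)
  show "integrable (lebesgue_on S) (\<lambda>x. (u x)\<^sup>2 + (v x)\<^sup>2)"
    using assms by (auto simp: square_integrable_def)
  show "(\<lambda>x. u x * v x) \<in> borel_measurable (lebesgue_on S)"
    using assms by (auto simp: square_integrable_def)
  have "\<bar>u x * v x\<bar> \<le> \<bar>(u x)\<^sup>2 + (v x)\<^sup>2\<bar>" for x
  proof -
    have "0 \<le> \<bar>u x\<bar> * \<bar>v x\<bar>" "2 * (\<bar>u x\<bar> * \<bar>v x\<bar>) \<le> (u x)\<^sup>2 + (v x)\<^sup>2"
      using sum_squares_bound[of "\<bar>u x\<bar>" "\<bar>v x\<bar>"] by (simp_all add: mult.assoc)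
    then show ?thesis
      unfolding abs_mult by linarith
  qed
  then show "AE x in lebesgue_on S. norm (u x * v x) \<le> norm ((u x)\<^sup>2 + (v x)\<^sup>2)"
    by simp
qed

lemma square_integrable_add:
  assumes "square_integrable S u" "square_integrable S v"
  shows "square_integrable S (\<lambda>x. u x + v x)"
  using assms square_integrable_mult_integrable[OF assms]
  unfolding square_integrable_def power2_sum
  by (auto simp: mult.assoc)

lemma square_integrable_cmult:
  assumes "square_integrable S u"
  shows "square_integrable S (\<lambda>x. c * u x)"
  using assms unfolding square_integrable_def by (auto simp: power_mult_distrib)

lemma square_integrable_diff:
  assumes "square_integrable S u" "square_integrable S v"
  shows "square_integrable S (\<lambda>x. u x - v x)"
  using square_integrable_add[OF assms(1) square_integrable_cmult[OF assms(2), of "-1"]] by simp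

text \<open>
  The quadratic polynomial \<open>\<integral>(t u + v)\<^sup>2\<close> is nonnegative in \<open>t\<close>.
\<close>

lemma square_integrable_Cauchy_Schwarz:
  assumes "square_integrable S u" "square_integrable S v"
  shows "(integral\<^sup>L (lebesgue_on S) (\<lambda>x. u x * v x))\<^sup>2 \<le>
    integral\<^sup>L (lebesgue_on S) (\<lambda>x. (u x)\<^sup>2) * integral\<^sup>L (lebesgue_on S) (\<lambda>x. (v x)\<^sup>2)"
proof -
  let ?a = "integral\<^sup>L (lebesgue_on S) (\<lambda>x. (u x)\<^sup>2)"
  let ?b = "integral\<^sup>L (lebesgue_on S) (\<lambda>x. (v x)\<^sup>2)"
  let ?c = "integral\<^sup>L (lebesgue_on S) (\<lambda>x. u x * v x)"
  have int: "integrable (lebesgue_on S) (\<lambda>x. (u x)\<^sup>2)" "integrable (lebesgue_on S) (\<lambda>x. (v x)\<^sup>2)"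
      "integrable (lebesgue_on S) (\<lambda>x. u x * v x)"
    using assms square_integrable_mult_integrable by (auto simp: square_integrable_def)
  have quad: "0 \<le> t\<^sup>2 * ?a + 2 * t * ?c + ?b" for t
  proof -
    have "0 \<le> integral\<^sup>L (lebesgue_on S) (\<lambda>x. (t * u x + v x)\<^sup>2)"
      by simp
    also have "(\<lambda>x. (t * u x + v x)\<^sup>2) = (\<lambda>x. t\<^sup>2 * (u x)\<^sup>2 + 2 * t * (u x * v x) + (v x)\<^sup>2)"
      by (simp add: fun_eq_iff power2_eq_square algebra_simps)
    finally show ?thesis
      using int by simp
  qed
  have "?a \<ge> 0" by simp
  show ?thesis
  proof (cases "?a = 0")
    case True
    have "?c = 0"
    proof (rule ccontr)
      assume "?c \<noteq> 0"
      then show False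
        \<comment> \<open>For \<open>?a = 0\<close> the polynomial is affine, and this \<open>t\<close> gives it the value \<open>-1\<close>.\<close>
        using quad[of "- (?b + 1) / (2 * ?c)"] True by (simp add: field_simps)
    qed
    then show ?thesis by simp
  next
    case False
    then have "?a > 0" using \<open>?a \<ge> 0\<close> by linarith
    then show ?thesis
      using quad[of "- ?c / ?a"] by (simp add: field_simps power2_eq_square)
  qed
qed

lemma tendsto_integral_mult_L2_null:
  assumes u: "square_integrable S u" and g: "\<And>n. square_integrable S (g n)"
    and lim: "(\<lambda>n. integral\<^sup>L (lebesgue_on S) (\<lambda>x. (g n x)\<^sup>2)) \<longlonglongrightarrow> 0"
  shows "(\<lambda>n. integral\<^sup>L (lebesgue_on S) (\<lambda>x. u x * g n x)) \<longlonglongrightarrow> 0"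
proof -
  have "(\<lambda>n. (integral\<^sup>L (lebesgue_on S) (\<lambda>x. u x * g n x))\<^sup>2) \<longlonglongrightarrow> 0"
  proof (rule tendsto_sandwich[OF always_eventually always_eventually tendsto_const])
    show "(\<lambda>n. integral\<^sup>L (lebesgue_on S) (\<lambda>x. (u x)\<^sup>2) * integral\<^sup>L (lebesgue_on S) (\<lambda>x. (g n x)\<^sup>2)) \<longlonglongrightarrow> 0"
      using tendsto_mult_right_zero[OF lim] .
  qed (use square_integrable_Cauchy_Schwarz[OF u g] in auto)
  then show ?thesis
    by (simp add: power_tendsto_0_iff)
qed

lemma tendsto_integral_mult_L2:
  assumes u: "square_integrable S u" and f: "\<And>n. square_integrable S (f n)" and g: "square_integrable S g"
    and lim: "(\<lambda>n. integral\<^sup>L (lebesgue_on S) (\<lambda>x. (f n x - g x)\<^sup>2)) \<longlonglongrightarrow> 0"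
  shows "(\<lambda>n. integral\<^sup>L (lebesgue_on S) (\<lambda>x. u x * f n x)) \<longlonglongrightarrow> integral\<^sup>L (lebesgue_on S) (\<lambda>x. u x * g x)"
proof -
  have "(\<lambda>n. integral\<^sup>L (lebesgue_on S) (\<lambda>x. u x * (f n x - g x))) \<longlonglongrightarrow> 0"
    by (rule tendsto_integral_mult_L2_null[OF u square_integrable_diff[OF f g] lim])
  moreover have "integral\<^sup>L (lebesgue_on S) (\<lambda>x. u x * (f n x - g x)) =
      integral\<^sup>L (lebesgue_on S) (\<lambda>x. u x * f n x) - integral\<^sup>L (lebesgue_on S) (\<lambda>x. u x * g x)" for n
    using square_integrable_mult_integrable[OF u f[of n]] square_integrable_mult_integrable[OF u g]
    by (simp add: right_diff_distrib)
  ultimately show ?thesis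
    by (simp add: LIM_zero_iff)
qed

lemma tendsto_integral_power2_L2:
  assumes f: "\<And>n. square_integrable S (f n)" and g: "square_integrable S g"
    and lim: "(\<lambda>n. integral\<^sup>L (lebesgue_on S) (\<lambda>x. (f n x - g x)\<^sup>2)) \<longlonglongrightarrow> 0"
  shows "(\<lambda>n. integral\<^sup>L (lebesgue_on S) (\<lambda>x. (f n x)\<^sup>2)) \<longlonglongrightarrow> integral\<^sup>L (lebesgue_on S) (\<lambda>x. (g x)\<^sup>2)"
proof -
  let ?I = "integral\<^sup>L (lebesgue_on S)"
  have "integrable (lebesgue_on S) (\<lambda>x. (f n x - g x)\<^sup>2)" for n
    using square_integrable_diff[OF f[of n] g] by (simp add: square_integrable_def)
  moreover have "integrable (lebesgue_on S) (\<lambda>x. g x * (f n x - g x))" for n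
    using square_integrable_mult_integrable[OF g square_integrable_diff[OF f g]] .
  moreover have "integrable (lebesgue_on S) (\<lambda>x. (g x)\<^sup>2)"
    using g by (simp add: square_integrable_def)
  moreover have "(f n x)\<^sup>2 = (f n x - g x)\<^sup>2 + 2 * (g x * (f n x - g x)) + (g x)\<^sup>2" for n x
    by (simp add: power2_eq_square algebra_simps)
  ultimately have "?I (\<lambda>x. (f n x)\<^sup>2) =
      ?I (\<lambda>x. (f n x - g x)\<^sup>2) + 2 * ?I (\<lambda>x. g x * (f n x - g x)) + ?I (\<lambda>x. (g x)\<^sup>2)" for n
    by simp
  moreover have "(\<lambda>n. ?I (\<lambda>x. (f n x - g x)\<^sup>2) + 2 * ?I (\<lambda>x. g x * (f n x - g x)) + ?I (\<lambda>x. (g x)\<^sup>2))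
      \<longlonglongrightarrow> 0 + 2 * 0 + ?I (\<lambda>x. (g x)\<^sup>2)"
    by (intro tendsto_intros lim tendsto_integral_mult_L2_null g square_integrable_diff f)
  ultimately show ?thesis
    by simp
qed

section \<open>The fundamental lemma of the calculus of variations\<close>

text \<open>
  Open boxes are stable under intersection and generate the Borel sets, and the sets on which \<open>g\<close>
  has integral zero are closed under complements and countable disjoint unions.
\<close>

lemma borel_set_integral_eq_0_of_boxes:
  fixes g :: "'a::euclidean_space \<Rightarrow> real"
  assumes g: "integrable lborel g"
    and box: "\<And>a b. integral\<^sup>L lborel (\<lambda>x. g x * indicator (box a b) x) = 0"
    and total: "integral\<^sup>L lborel g = 0"
    and E: "E \<in> sets borel"
  shows "integral\<^sup>L lborel (\<lambda>x. g x * indicator E x) = 0"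
proof -
  let ?G = "range (\<lambda>(a, b). box a b :: 'a set)"
  have sets_eq: "sets borel = sigma_sets UNIV ?G"
    by (subst borel_eq_box) simp
  have int: "integrable lborel (\<lambda>x. g x * indicator A x)" if "A \<in> sets borel" for A
    using integrable_real_mult_indicator[OF _ g, of A] that by simp
  have "Int_stable ?G"
    unfolding Int_stable_def by (auto simp: box_Int_box)
  moreover have "?G \<subseteq> Pow UNIV" "E \<in> sigma_sets UNIV ?G"
    using E sets_eq by auto
  ultimately show ?thesis
  proof (induction rule: sigma_sets_induct_disjoint)
    case (basic A)
    then show ?case using box by auto
  next
    case empty
    then show ?case by simp
  next
    case (compl A)
    then have "A \<in> sets borel" by (simp add: sets_eq)
    have "(\<lambda>x. g x * indicator (UNIV - A) x) = (\<lambda>x. g x - g x * indicator A x)"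
      by (auto simp: fun_eq_iff indicator_def)
    then show ?case
      using compl g total int[OF \<open>A \<in> sets borel\<close>] by simp
  next
    case (union A)
    then have A: "\<And>i. A i \<in> sets borel" by (auto simp: sets_eq)
    have "integral\<^sup>L lborel (\<lambda>x. g x * indicator (\<Union>i. A i) x) = (LINT x:(\<Union>i. A i)|lborel. g x)"
      by (simp add: set_lebesgue_integral_def mult.commute)
    also have "\<dots> = (\<Sum>i. LINT x:A i|lborel. g x)"
    proof (rule lebesgue_integral_countable_add)
      show "set_integrable lborel (\<Union>i. A i) g"
        using int[of "\<Union>i. A i"] A by (simp add: set_integrable_def mult.commute)
    qed (use A union in \<open>auto simp: disjoint_family_on_def\<close>)
    also have "\<dots> = 0"
      using union by (simp add: set_lebesgue_integral_def mult.commute)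
    finally show ?case .
  qed
qed

text \<open>
  Testing against the bump functions shows, in the limit, that \<open>g\<close> has integral zero over every box
  whose closure lies in \<open>S\<close>, hence over every Borel subset of such a box, hence vanishes almost
  everywhere there. Countably many of these boxes cover \<open>S\<close>. The argument is carried out for a Borel
  representative \<open>g'\<close> of \<open>g\<close>, as Borel sets are what the boxes generate.
\<close>

lemma fundamental_lemma_of_variations:
  fixes g :: "'a::euclidean_space \<Rightarrow> real"
  assumes S: "open S" and g: "integrable (lebesgue_on S) g"
    and orth: "\<And>\<phi>. \<phi> \<in> test_functions S \<Longrightarrow> integral\<^sup>L (lebesgue_on S) (\<lambda>x. g x * \<phi> x) = 0"
  shows "AE x in lebesgue_on S. g x = 0"
proof -
  have S_sets: "S \<in> sets lebesgue" using S by simp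
  define G where "G x = indicator S x * g x" for x
  have G: "integrable lebesgue G"
    using g S_sets by (simp add: G_def[abs_def] integrable_restrict_space)
  obtain g' where g'[measurable]: "g' \<in> borel_measurable borel" and ae: "AE x in lborel. G x = g' x"
    using completion_ex_borel_measurable_real[of G lborel] G by auto
  have ae': "AE x in lebesgue. G x = g' x"
    using ae by (rule AE_completion)
  have g'_int: "integrable lborel g'"
    using integrable_cong_AE[OF _ _ ae'] G by (simp add: integrable_completion measurable_completion borel_measurable_integrable)
  have transfer: "integral\<^sup>L (lebesgue_on S) (\<lambda>x. g x * h x) = integral\<^sup>L lborel (\<lambda>x. g' x * h x)"
    if [measurable]: "h \<in> borel_measurable borel" for h
  proof -
    have h': "h \<in> borel_measurable lebesgue" "g' \<in> borel_measurable lebesgue"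
      by (simp_all add: measurable_completion)
    have "integral\<^sup>L (lebesgue_on S) (\<lambda>x. g x * h x) = integral\<^sup>L lebesgue (\<lambda>x. G x * h x)"
      using S_sets by (simp add: integral_restrict_space G_def mult.assoc)
    also have "\<dots> = integral\<^sup>L lebesgue (\<lambda>x. g' x * h x)"
      by (rule integral_cong_AE) (use ae' h' G in \<open>auto intro: borel_measurable_integrable\<close>)
    also have "\<dots> = integral\<^sup>L lborel (\<lambda>x. g' x * h x)"
      by (rule integral_completion) simp
    finally show ?thesis .
  qed
  have box_0: "integral\<^sup>L lborel (\<lambda>x. g' x * indicator (box a b) x) = 0" if "cbox a b \<subseteq> S" for a b
  proof -
    have meas[measurable]: "box_bump a b n \<in> borel_measurable borel" for n
      using box_bump_test_function[of a b UNIV n] test_function_continuous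
        borel_measurable_continuous_onI by blast
    have "(\<lambda>n. integral\<^sup>L lborel (\<lambda>x. g' x * box_bump a b n x)) \<longlonglongrightarrow> integral\<^sup>L lborel (\<lambda>x. g' x * indicator (box a b) x)"
    proof (rule integral_dominated_convergence[where w = "\<lambda>x. norm (g' x)"])
      show "AE x in lborel. norm (g' x * box_bump a b n x) \<le> norm (g' x)" for n
        using box_bump_bounds[of a b n] by (intro AE_I2) (auto simp: abs_mult intro!: mult_left_le)
    qed (use g'_int in \<open>auto intro!: tendsto_intros box_bump_tendsto\<close>)
    moreover have "integral\<^sup>L lborel (\<lambda>x. g' x * box_bump a b n x) = 0" for n
      using orth[OF box_bump_test_function[OF that, of n]] transfer[OF meas, of n] by simp
    ultimately show ?thesis
      by (simp add: LIMSEQ_const_iff)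
  qed
  have box_AE: "AE x in lborel. x \<in> box a b \<longrightarrow> g' x = 0" if ab: "cbox a b \<subseteq> S" for a b
  proof -
    let ?f = "\<lambda>x. g' x * indicator (box a b) x"
    have f_int: "integrable lborel ?f"
      using integrable_real_mult_indicator[OF _ g'_int, of "box a b"] by simp
    have "AE x in lborel. ?f x = 0"
    proof (rule sigma_finite_measure.density_zero[OF sigma_finite_lborel f_int])
      fix E :: "'a set" assume "E \<in> sets lborel"
      have "integral\<^sup>L lborel (\<lambda>x. ?f x * indicator E x) = 0"
      proof (rule borel_set_integral_eq_0_of_boxes[OF f_int])
        fix c d :: 'a
        obtain a' b' where I: "box a b \<inter> box c d = box a' b'"
          by (simp add: box_Int_box)
        have "box a' b' \<subseteq> box a b" using I by blast
        have "integral\<^sup>L lborel (\<lambda>x. g' x * indicator (box a' b') x) = 0"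
        proof (cases "box a' b' = {}")
          case False
          have "cbox a' b' \<subseteq> cbox a b"
            using closure_mono[OF \<open>box a' b' \<subseteq> box a b\<close>] False \<open>box a' b' \<subseteq> box a b\<close>
            by (metis closure_box subset_empty)
          then show ?thesis
            using box_0 ab by blast
        qed simp
        then show "integral\<^sup>L lborel (\<lambda>x. ?f x * indicator (box c d) x) = 0"
          by (simp add: mult.assoc indicator_inter_arith[symmetric] I)
      qed (use box_0[OF ab] \<open>E \<in> sets lborel\<close> in auto)
      then show "set_lebesgue_integral lborel E ?f = 0"
        by (simp add: set_lebesgue_integral_def mult.commute)
    qed
    then show ?thesis
      by (auto elim!: eventually_mono simp: indicator_def)
  qed
  let ?F = "{box a b |a b :: 'a. cbox a b \<subseteq> S}"
  have "\<Union>?F = S"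
  proof
    show "\<Union>?F \<subseteq> S"
      using box_subset_cbox by blast
    show "S \<subseteq> \<Union>?F"
    proof
      fix x assume "x \<in> S"
      then obtain a b where "cbox a b \<subseteq> S" "x \<in> box a b"
        using open_contains_cbox[OF S] by metis
      then show "x \<in> \<Union>?F" by blast
    qed
  qed
  moreover obtain F' where F': "F' \<subseteq> ?F" "countable F'" "\<Union>F' = \<Union>?F"
    by (rule Lindelof[of ?F]) auto
  ultimately have "\<Union>F' = S" by simp
  have "AE x in lborel. \<forall>X\<in>F'. x \<in> X \<longrightarrow> g' x = 0"
    using F' box_AE by (subst AE_ball_countable) auto
  then have "AE x in lborel. x \<in> S \<longrightarrow> g x = 0"
    using ae by eventually_elim (use \<open>\<Union>F' = S\<close> in \<open>auto simp: G_def indicator_def split: if_splits\<close>)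
  then have "AE x in lebesgue. x \<in> S \<longrightarrow> g x = 0"
    by (rule AE_completion)
  then show ?thesis
    using S_sets by (simp add: AE_restrict_space_iff)
qed

section \<open>Weak derivatives\<close>

lemma test_function_square_integrable:
  assumes "\<phi> \<in> test_functions S" "S \<in> sets borel"
  shows "square_integrable S \<phi>"
proof -
  obtain K where K: "compact K" "K \<subseteq> S" "\<And>x. x \<notin> K \<Longrightarrow> \<phi> x = 0"
    using test_function_support[OF assms(1)] by blast
  have cont: "continuous_on UNIV \<phi>"
    using test_function_continuous[OF assms(1)] .
  have [measurable]: "\<phi> \<in> borel_measurable borel"
    by (rule borel_measurable_continuous_onI[OF cont])
  have "integrable lborel (\<lambda>x. (\<phi> x)\<^sup>2)"
    using cont K by (intro integrable_lborel_continuous_compact_support[where K = K] continuous_intros) auto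
  then have "integrable (lebesgue_on S) (\<lambda>x. (\<phi> x)\<^sup>2)"
    using K assms(2) by (subst integral_lebesgue_on_eq_lborel) auto
  then show ?thesis
    by (auto simp: square_integrable_def intro: borel_measurable_lebesgue_on)
qed

lemma test_function_integral_lborel:
  assumes "\<phi> \<in> test_functions S" "S \<in> sets borel" "h \<in> borel_measurable borel"
  shows "integral\<^sup>L (lebesgue_on S) (\<lambda>x. h x * \<phi> x) = integral\<^sup>L lborel (\<lambda>x. h x * \<phi> x)"
proof -
  obtain K where K: "K \<subseteq> S" "\<And>x. x \<notin> K \<Longrightarrow> \<phi> x = 0"
    using test_function_support[OF assms(1)] by blast
  have [measurable]: "\<phi> \<in> borel_measurable borel"
    by (rule borel_measurable_continuous_onI[OF test_function_continuous[OF assms(1)]])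
  show ?thesis
    by (rule integral_lebesgue_on_eq_lborel) (use K assms in auto)
qed

lemma has_weak_deriv_test_function:
  assumes "\<phi> \<in> test_functions S" "S \<in> sets borel" "b \<in> Basis"
  shows "has_weak_deriv S b \<phi> (pdiff b \<phi>)"
  unfolding has_weak_deriv_def
proof (intro conjI ballI)
  have D: "pdiff b \<phi> \<in> test_functions S"
    using pdiff_test_function assms by blast
  show "square_integrable S \<phi>" "square_integrable S (pdiff b \<phi>)"
    using test_function_square_integrable assms D by blast+
  fix \<psi> assume \<psi>: "\<psi> \<in> test_functions S"
  have D\<psi>: "pdiff b \<psi> \<in> test_functions S"
    using pdiff_test_function \<psi> assms by blast
  have meas: "\<phi> \<in> borel_measurable borel" "pdiff b \<phi> \<in> borel_measurable borel"
    using assms D borel_measurable_continuous_onI test_function_continuous by blast+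
  show "integral\<^sup>L (lebesgue_on S) (\<lambda>x. \<phi> x * frechet_derivative \<psi> (at x) b) =
      - integral\<^sup>L (lebesgue_on S) (\<lambda>x. pdiff b \<phi> x * \<psi> x)"
    using integral_by_parts_test_function[OF assms(1) \<psi> assms(3)]
    unfolding pdiff_def[of b \<psi>, symmetric]
    by (simp add: test_function_integral_lborel[OF D\<psi> assms(2) meas(1)]
        test_function_integral_lborel[OF \<psi> assms(2) meas(2)])
qed

lemma square_integrable_imp_integrable:
  assumes "square_integrable S u" "S \<in> lmeasurable"
  shows "integrable (lebesgue_on S) u"
proof -
  have "finite_measure (lebesgue_on S)"
    using assms(2) by (rule finite_measure_lebesgue_on)
  then have "integrable (lebesgue_on S) (\<lambda>x. (1::real)\<^sup>2)"
    by (simp add: finite_measure.integrable_const)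
  then have "square_integrable S (\<lambda>x. 1)"
    by (simp add: square_integrable_def)
  from square_integrable_mult_integrable[OF this assms(1)] show ?thesis
    by simp
qed

lemma has_weak_deriv_unique:
  assumes S: "open S" "bounded S" and g: "has_weak_deriv S b u g" and g': "has_weak_deriv S b u g'"
  shows "AE x in lebesgue_on S. g x = g' x"
proof -
  have L2: "square_integrable S g" "square_integrable S g'"
    using g g' by (auto simp: has_weak_deriv_def)
  have "S \<in> lmeasurable"
    using S by (simp add: lmeasurable_open)
  have "AE x in lebesgue_on S. g x - g' x = 0"
  proof (rule fundamental_lemma_of_variations[OF S(1)])
    show "integrable (lebesgue_on S) (\<lambda>x. g x - g' x)"
      by (rule square_integrable_imp_integrable[OF square_integrable_diff[OF L2] \<open>S \<in> lmeasurable\<close>])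
    fix \<phi> assume \<phi>: "\<phi> \<in> test_functions S"
    have \<phi>2: "square_integrable S \<phi>"
      using test_function_square_integrable[OF \<phi>] S by simp
    have "integral\<^sup>L (lebesgue_on S) (\<lambda>x. g x * \<phi> x) = integral\<^sup>L (lebesgue_on S) (\<lambda>x. g' x * \<phi> x)"
      using g g' \<phi> by (simp add: has_weak_deriv_def)
    then show "integral\<^sup>L (lebesgue_on S) (\<lambda>x. (g x - g' x) * \<phi> x) = 0"
      using square_integrable_mult_integrable[OF L2(1) \<phi>2] square_integrable_mult_integrable[OF L2(2) \<phi>2]
      by (simp add: left_diff_distrib)
  qed
  then show ?thesis by simp
qed

lemma has_weak_deriv_add_cmult:
  assumes S: "open S" and "b \<in> Basis"
    and u: "has_weak_deriv S b u g" and v: "has_weak_deriv S b v h"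
  shows "has_weak_deriv S b (\<lambda>x. u x + t * v x) (\<lambda>x. g x + t * h x)"
proof -
  have L2: "square_integrable S u" "square_integrable S v" "square_integrable S g" "square_integrable S h"
    using u v by (auto simp: has_weak_deriv_def)
  show ?thesis
    unfolding has_weak_deriv_def
  proof (intro conjI ballI square_integrable_add square_integrable_cmult L2)
    fix \<phi> assume \<phi>: "\<phi> \<in> test_functions S"
    have \<phi>2: "square_integrable S \<phi>"
      using test_function_square_integrable[OF \<phi>] S by simp
    have D\<phi>2: "square_integrable S (\<lambda>x. frechet_derivative \<phi> (at x) b)"
      using test_function_square_integrable[OF pdiff_test_function[OF \<phi> \<open>b \<in> Basis\<close>]] S
      by (simp add: pdiff_def[abs_def])
    note int = L2(1,2)[THEN square_integrable_mult_integrable, OF D\<phi>2]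
      L2(3,4)[THEN square_integrable_mult_integrable, OF \<phi>2]
    show "integral\<^sup>L (lebesgue_on S) (\<lambda>x. (u x + t * v x) * frechet_derivative \<phi> (at x) b) =
        - integral\<^sup>L (lebesgue_on S) (\<lambda>x. (g x + t * h x) * \<phi> x)"
      using u v \<phi> int by (simp add: has_weak_deriv_def distrib_right mult.assoc)
  qed
qed

lemma W12_has_weak_deriv: "u \<in> W12 S \<Longrightarrow> b \<in> Basis \<Longrightarrow> has_weak_deriv S b u (weak_deriv S b u)"
  unfolding W12_def weak_deriv_def by (blast intro: someI[where P = "has_weak_deriv S b u"])

lemma W12_square_integrable: "u \<in> W12 S \<Longrightarrow> square_integrable S u"
  by (simp add: W12_def)

lemma W12_weak_deriv_square_integrable:
  "u \<in> W12 S \<Longrightarrow> b \<in> Basis \<Longrightarrow> square_integrable S (weak_deriv S b u)"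
  using W12_has_weak_deriv by (auto simp: has_weak_deriv_def)

lemma W12I: "(\<And>b. b \<in> Basis \<Longrightarrow> has_weak_deriv S b u (g b)) \<Longrightarrow> u \<in> W12 S"
  using SOME_Basis by (auto simp: W12_def has_weak_deriv_def)

lemma test_function_W12: "\<phi> \<in> test_functions S \<Longrightarrow> open S \<Longrightarrow> \<phi> \<in> W12 S"
  by (rule W12I[OF has_weak_deriv_test_function]) auto

lemma W12_add_cmult: "u \<in> W12 S \<Longrightarrow> v \<in> W12 S \<Longrightarrow> open S \<Longrightarrow> (\<lambda>x. u x + t * v x) \<in> W12 S"
  by (rule W12I[OF has_weak_deriv_add_cmult]) (auto intro: W12_has_weak_deriv)

text \<open>
  Identifies the chosen representative with any explicit weak derivative.
\<close>

lemma weak_deriv_AE_eq: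
  assumes "open S" "bounded S" "has_weak_deriv S b u g"
  shows "AE x in lebesgue_on S. weak_deriv S b u x = g x"
proof -
  have "has_weak_deriv S b u (weak_deriv S b u)"
    unfolding weak_deriv_def using assms(3) by (rule someI[where P = "has_weak_deriv S b u"])
  then show ?thesis
    using has_weak_deriv_unique assms by blast
qed

lemma weak_deriv_add_cmult:
  assumes "open S" "bounded S" "b \<in> Basis" "u \<in> W12 S" "v \<in> W12 S"
  shows "AE x in lebesgue_on S.
    weak_deriv S b (\<lambda>x. u x + t * v x) x = weak_deriv S b u x + t * weak_deriv S b v x"
  using assms by (intro weak_deriv_AE_eq has_weak_deriv_add_cmult W12_has_weak_deriv)

section \<open>Approximation by test functions\<close>

lemma W12_0_W12: "u \<in> W12_0 S \<Longrightarrow> u \<in> W12 S"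
  by (simp add: W12_0_def)

text \<open>
  Convergence in the Sobolev norm, split into its components and with the chosen weak derivative of
  \<open>\<phi> n - u\<close> replaced by the difference of derivatives.
\<close>

definition W12_limit :: "'a::euclidean_space set \<Rightarrow> (nat \<Rightarrow> 'a \<Rightarrow> real) \<Rightarrow> ('a \<Rightarrow> real) \<Rightarrow> bool" where
  "W12_limit S \<phi> u \<longleftrightarrow> (\<forall>n. \<phi> n \<in> test_functions S) \<and>
    (\<lambda>n. integral\<^sup>L (lebesgue_on S) (\<lambda>x. (\<phi> n x - u x)\<^sup>2)) \<longlonglongrightarrow> 0 \<and>
    (\<forall>b\<in>Basis. (\<lambda>n. integral\<^sup>L (lebesgue_on S) (\<lambda>x. (pdiff b (\<phi> n) x - weak_deriv S b u x)\<^sup>2)) \<longlonglongrightarrow> 0)"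

lemma W12_0_approx:
  assumes S: "open S" "bounded S" and u: "u \<in> W12_0 S"
  shows "\<exists>\<phi>. W12_limit S \<phi> u"
proof -
  obtain \<phi> where \<phi>: "\<And>n. \<phi> n \<in> test_functions S"
    and lim: "(\<lambda>n. W12_norm S (\<lambda>x. \<phi> n x - u x)) \<longlonglongrightarrow> 0"
    using u unfolding W12_0_def by blast
  let ?I = "integral\<^sup>L (lebesgue_on S)"
  have uW: "u \<in> W12 S" using u by (rule W12_0_W12)
  have eq: "?I (\<lambda>x. (weak_deriv S b (\<lambda>x. \<phi> n x - u x) x)\<^sup>2) = ?I (\<lambda>x. (pdiff b (\<phi> n) x - weak_deriv S b u x)\<^sup>2)"
    if "b \<in> Basis" for b n
  proof (rule integral_cong_AE)
    have wd: "has_weak_deriv S b (\<lambda>x. \<phi> n x + (-1) * u x) (\<lambda>x. pdiff b (\<phi> n) x + (-1) * weak_deriv S b u x)"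
      using S that \<phi> uW
      by (intro has_weak_deriv_add_cmult has_weak_deriv_test_function W12_has_weak_deriv) auto
    then have wd: "has_weak_deriv S b (\<lambda>x. \<phi> n x - u x) (\<lambda>x. pdiff b (\<phi> n) x - weak_deriv S b u x)"
      by simp
    then have "has_weak_deriv S b (\<lambda>x. \<phi> n x - u x) (weak_deriv S b (\<lambda>x. \<phi> n x - u x))"
      unfolding weak_deriv_def[of S b "\<lambda>x. \<phi> n x - u x"]
      by (rule someI[where P = "has_weak_deriv S b (\<lambda>x. \<phi> n x - u x)"])
    with wd show "(\<lambda>x. (weak_deriv S b (\<lambda>x. \<phi> n x - u x) x)\<^sup>2) \<in> borel_measurable (lebesgue_on S)"
      "(\<lambda>x. (pdiff b (\<phi> n) x - weak_deriv S b u x)\<^sup>2) \<in> borel_measurable (lebesgue_on S)"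
      by (auto simp: has_weak_deriv_def square_integrable_def)
    show "AE x in lebesgue_on S.
        (weak_deriv S b (\<lambda>x. \<phi> n x - u x) x)\<^sup>2 = (pdiff b (\<phi> n) x - weak_deriv S b u x)\<^sup>2"
      using weak_deriv_AE_eq[OF S wd] by eventually_elim simp
  qed
  let ?s = "\<lambda>n. ?I (\<lambda>x. (\<phi> n x - u x)\<^sup>2) + (\<Sum>b\<in>Basis. ?I (\<lambda>x. (pdiff b (\<phi> n) x - weak_deriv S b u x)\<^sup>2))"
  have "(\<lambda>n. sqrt (?s n)) \<longlonglongrightarrow> 0"
    using lim unfolding W12_norm_def by (simp add: eq cong: sum.cong)
  then have "(\<lambda>n. (sqrt (?s n))\<^sup>2) \<longlonglongrightarrow> 0\<^sup>2"
    by (rule tendsto_power)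
  moreover have "?s n \<ge> 0" for n
    by (intro add_nonneg_nonneg sum_nonneg) auto
  ultimately have s: "?s \<longlonglongrightarrow> 0"
    by simp
  show ?thesis
    unfolding W12_limit_def
  proof (intro exI[of _ \<phi>] conjI allI ballI \<phi>)
    show "(\<lambda>n. ?I (\<lambda>x. (\<phi> n x - u x)\<^sup>2)) \<longlonglongrightarrow> 0"
    proof (rule tendsto_sandwich[OF always_eventually always_eventually tendsto_const s])
      show "\<forall>n. ?I (\<lambda>x. (\<phi> n x - u x)\<^sup>2) \<le> ?s n"
        by (auto intro!: sum_nonneg)
    qed auto
    fix b :: 'a assume b: "b \<in> Basis"
    show "(\<lambda>n. ?I (\<lambda>x. (pdiff b (\<phi> n) x - weak_deriv S b u x)\<^sup>2)) \<longlonglongrightarrow> 0"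
    proof (rule tendsto_sandwich[OF always_eventually always_eventually tendsto_const s])
      have "?I (\<lambda>x. (pdiff b (\<phi> n) x - weak_deriv S b u x)\<^sup>2)
          \<le> (\<Sum>b\<in>Basis. ?I (\<lambda>x. (pdiff b (\<phi> n) x - weak_deriv S b u x)\<^sup>2))" for n
        using b by (intro member_le_sum) auto
      then show "\<forall>n. ?I (\<lambda>x. (pdiff b (\<phi> n) x - weak_deriv S b u x)\<^sup>2) \<le> ?s n"
        by (auto intro!: add_increasing)
    qed auto
  qed
qed

lemma weak_deriv_zero_AE:
  assumes "open S" "bounded S" "b \<in> Basis"
  shows "AE x in lebesgue_on S. weak_deriv S b (\<lambda>x. 0) x = 0"
proof (rule weak_deriv_AE_eq[OF assms(1,2)])
  have "pdiff b (\<lambda>x. 0) = (\<lambda>x. 0)"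
    by (simp add: pdiff_def fun_eq_iff)
  then show "has_weak_deriv S b (\<lambda>x. 0) (\<lambda>x. 0)"
    using has_weak_deriv_test_function[OF zero_test_function _ assms(3), of S] assms(1) by simp
qed

lemma zero_W12_0:
  assumes "open S" "bounded S"
  shows "(\<lambda>x. 0) \<in> W12_0 S"
proof -
  have Z: "(\<lambda>x. 0) \<in> test_functions S" by (rule zero_test_function)
  have "integral\<^sup>L (lebesgue_on S) (\<lambda>x. (weak_deriv S b (\<lambda>x. 0) x)\<^sup>2) = 0" if "b \<in> Basis" for b
  proof (rule integral_eq_zero_AE)
    show "AE x in lebesgue_on S. (weak_deriv S b (\<lambda>x. 0) x)\<^sup>2 = 0"
      using weak_deriv_zero_AE[OF assms that]
      by eventually_elim simp
  qed
  then have "W12_norm S (\<lambda>x. 0) = 0"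
    by (simp add: W12_norm_def)
  then show ?thesis
    using Z test_function_W12[OF Z assms(1)] unfolding W12_0_def
    by (auto intro!: exI[of _ "\<lambda>n x. 0"])
qed

section \<open>The Poincare inequality and the null Lagrangian\<close>

text \<open>
  The function \<open>(x \<bullet> b) \<phi>\<^sup>2\<close> has compact support, so the integral of its derivative along \<open>b\<close>,
  \<open>\<phi>\<^sup>2 + 2 (x \<bullet> b) \<phi> \<partial>\<^sub>b \<phi>\<close>, vanishes. Completing the square bounds this integrand below by
  \<open>\<phi>\<^sup>2 / 2 - 2 R\<^sup>2 (\<partial>\<^sub>b \<phi>)\<^sup>2\<close>.
\<close>

lemma poincare_test_function:
  fixes S :: "'a::euclidean_space set"
  assumes S: "open S" and R: "\<And>x. x \<in> S \<Longrightarrow> \<bar>x \<bullet> b\<bar> \<le> R"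
    and b: "b \<in> Basis" and \<phi>: "\<phi> \<in> test_functions S"
  shows "integral\<^sup>L (lebesgue_on S) (\<lambda>x. (\<phi> x)\<^sup>2) \<le>
    4 * R\<^sup>2 * integral\<^sup>L (lebesgue_on S) (\<lambda>x. (pdiff b \<phi> x)\<^sup>2)"
proof -
  obtain K where K: "compact K" "K \<subseteq> S" "\<And>x. x \<notin> K \<Longrightarrow> \<phi> x = 0"
    using test_function_support[OF \<phi>] by blast
  have D: "pdiff b \<phi> \<in> test_functions S"
    using pdiff_test_function \<phi> b by blast
  have cont: "continuous_on UNIV \<phi>" "continuous_on UNIV (pdiff b \<phi>)"
    using test_function_continuous \<phi> D by blast+
  let ?h = "\<lambda>x. (\<phi> x)\<^sup>2 + 2 * (x \<bullet> b) * \<phi> x * pdiff b \<phi> x"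
  have h_cont: "continuous_on UNIV ?h"
    using cont by (intro continuous_intros)
  have h_0: "?h x = 0" if "x \<notin> K" for x
    using K(3)[OF that] by simp
  then have h_0': "?h x = 0" if "x \<notin> S" for x
    using that K(2) by (meson subsetD)
  have S_borel: "S \<in> sets borel"
    using S by simp
  have "((\<lambda>x. (x \<bullet> b) * (\<phi> x)\<^sup>2) has_derivative
      (\<lambda>y. (y \<bullet> b) * (\<phi> x)\<^sup>2 + 2 * (x \<bullet> b) * \<phi> x * frechet_derivative \<phi> (at x) y)) (at x)" for x
    using test_function_has_derivative[OF \<phi>, of x]
    by (auto intro!: derivative_eq_intros simp: algebra_simps)
  from integral_directional_derivative_eq_0[OF this _ K(1), of b]
  have "integral\<^sup>L lborel ?h = 0"
    using h_cont K b by (simp add: pdiff_def[abs_def])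
  moreover have "integral\<^sup>L lborel ?h = integral\<^sup>L (lebesgue_on S) ?h"
    by (rule integral_lebesgue_on_eq_lborel(1)[symmetric,
          OF borel_measurable_continuous_onI[OF h_cont] S_borel h_0'])
  moreover have h_int: "integrable (lebesgue_on S) ?h"
    using integrable_lborel_continuous_compact_support[OF h_cont K(1) h_0]
      integral_lebesgue_on_eq_lborel(2)[OF borel_measurable_continuous_onI[OF h_cont] S_borel h_0'] by blast
  moreover have int: "integrable (lebesgue_on S) (\<lambda>x. (\<phi> x)\<^sup>2)" "integrable (lebesgue_on S) (\<lambda>x. (pdiff b \<phi> x)\<^sup>2)"
    using test_function_square_integrable[of _ S] \<phi> D S by (auto simp: square_integrable_def)
  moreover have "integral\<^sup>L (lebesgue_on S) (\<lambda>x. (\<phi> x)\<^sup>2 / 2 - 2 * R\<^sup>2 * (pdiff b \<phi> x)\<^sup>2) \<le> integral\<^sup>L (lebesgue_on S) ?h"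
  proof (rule integral_mono)
    fix x assume "x \<in> space (lebesgue_on S)"
    then have "\<bar>x \<bullet> b\<bar>\<^sup>2 \<le> R\<^sup>2"
      using R by (intro power_mono) auto
    then have "(x \<bullet> b)\<^sup>2 * (pdiff b \<phi> x)\<^sup>2 \<le> R\<^sup>2 * (pdiff b \<phi> x)\<^sup>2"
      by (intro mult_right_mono) auto
    moreover have "0 \<le> (\<phi> x + 2 * (x \<bullet> b) * pdiff b \<phi> x)\<^sup>2"
      by simp
    ultimately show "(\<phi> x)\<^sup>2 / 2 - 2 * R\<^sup>2 * (pdiff b \<phi> x)\<^sup>2 \<le> ?h x"
      by (simp add: power2_eq_square algebra_simps)
  qed (use int h_int in auto)
  ultimately show ?thesis
    by simp
qed

lemma poincare_W12_0:
  assumes S: "open S" "bounded S" and R: "\<And>x. x \<in> S \<Longrightarrow> \<bar>x \<bullet> b\<bar> \<le> R"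
    and b: "b \<in> Basis" and u: "u \<in> W12_0 S"
  shows "integral\<^sup>L (lebesgue_on S) (\<lambda>x. (u x)\<^sup>2) \<le>
    4 * R\<^sup>2 * integral\<^sup>L (lebesgue_on S) (\<lambda>x. (weak_deriv S b u x)\<^sup>2)"
proof -
  obtain \<phi> where "W12_limit S \<phi> u"
    using W12_0_approx[OF S u] by blast
  then have \<phi>: "\<phi> n \<in> test_functions S"
    and lim: "(\<lambda>n. integral\<^sup>L (lebesgue_on S) (\<lambda>x. (\<phi> n x - u x)\<^sup>2)) \<longlonglongrightarrow> 0"
      "(\<lambda>n. integral\<^sup>L (lebesgue_on S) (\<lambda>x. (pdiff b (\<phi> n) x - weak_deriv S b u x)\<^sup>2)) \<longlonglongrightarrow> 0"
    for n
    using b by (simp_all add: W12_limit_def)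
  have uW: "u \<in> W12 S" using u by (rule W12_0_W12)
  have L2: "square_integrable S (\<phi> n)" "square_integrable S (pdiff b (\<phi> n))" for n
    using test_function_square_integrable[OF \<phi>] test_function_square_integrable[OF pdiff_test_function[OF \<phi> b]] S
    by auto
  show ?thesis
  proof (rule LIMSEQ_le)
    show "(\<lambda>n. integral\<^sup>L (lebesgue_on S) (\<lambda>x. (\<phi> n x)\<^sup>2)) \<longlonglongrightarrow> integral\<^sup>L (lebesgue_on S) (\<lambda>x. (u x)\<^sup>2)"
      by (rule tendsto_integral_power2_L2[OF L2(1) W12_square_integrable[OF uW] lim(1)])
    show "(\<lambda>n. 4 * R\<^sup>2 * integral\<^sup>L (lebesgue_on S) (\<lambda>x. (pdiff b (\<phi> n) x)\<^sup>2)) \<longlonglongrightarrow>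
        4 * R\<^sup>2 * integral\<^sup>L (lebesgue_on S) (\<lambda>x. (weak_deriv S b u x)\<^sup>2)"
      by (intro tendsto_mult_left
          tendsto_integral_power2_L2[OF L2(2) W12_weak_deriv_square_integrable[OF uW b] lim(2)])
  qed (use poincare_test_function[OF S(1) R b \<phi>] in blast)
qed

text \<open>
  For a test function in place of \<open>w\<close>, moving the derivative of \<open>v\<close> onto the test function turns
  both sides into the integral of \<open>- v\<close> against the same mixed second derivative. Both sides are
  continuous in \<open>w\<close> for the Sobolev norm.
\<close>

lemma null_lagrangian_W12_0:
  assumes S: "open S" "bounded S" and b: "b \<in> Basis" and c: "c \<in> Basis"
    and v: "v \<in> W12 S" and w: "w \<in> W12_0 S"
  shows "integral\<^sup>L (lebesgue_on S) (\<lambda>x. weak_deriv S b v x * weak_deriv S c w x) =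
    integral\<^sup>L (lebesgue_on S) (\<lambda>x. weak_deriv S c v x * weak_deriv S b w x)"
proof -
  let ?I = "integral\<^sup>L (lebesgue_on S)"
  obtain \<psi> where "W12_limit S \<psi> w"
    using W12_0_approx[OF S w] by blast
  then have \<psi>: "\<psi> n \<in> test_functions S"
    and lim: "b \<in> Basis \<Longrightarrow> (\<lambda>n. ?I (\<lambda>x. (pdiff b (\<psi> n) x - weak_deriv S b w x)\<^sup>2)) \<longlonglongrightarrow> 0" for n b
    by (simp_all add: W12_limit_def)
  have wW: "w \<in> W12 S" using w by (rule W12_0_W12)
  have lim2: "(\<lambda>n. ?I (\<lambda>x. weak_deriv S b v x * pdiff c (\<psi> n) x)) \<longlonglongrightarrow> ?I (\<lambda>x. weak_deriv S b v x * weak_deriv S c w x)"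
    if "b \<in> Basis" "c \<in> Basis" for b c
  proof (rule tendsto_integral_mult_L2[OF W12_weak_deriv_square_integrable[OF v that(1)] _
        W12_weak_deriv_square_integrable[OF wW that(2)] lim[OF that(2)]])
    show "square_integrable S (pdiff c (\<psi> n))" for n
      using test_function_square_integrable[OF pdiff_test_function[OF \<psi> that(2)]] S by simp
  qed
  have by_parts: "?I (\<lambda>x. weak_deriv S b v x * pdiff c (\<psi> n) x) = - ?I (\<lambda>x. v x * pdiff b (pdiff c (\<psi> n)) x)"
    if "b \<in> Basis" "c \<in> Basis" for b c n
    using W12_has_weak_deriv[OF v that(1)] pdiff_test_function[OF \<psi> that(2), of n]
    by (simp add: has_weak_deriv_def pdiff_def[of b, abs_def])
  have "?I (\<lambda>x. weak_deriv S b v x * pdiff c (\<psi> n) x) = ?I (\<lambda>x. weak_deriv S c v x * pdiff b (\<psi> n) x)" for n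
    using by_parts[OF b c] by_parts[OF c b] pdiff_commute[OF test_function_Ck[OF \<psi>] b c] by simp
  then show ?thesis
    using LIMSEQ_unique[OF lim2[OF b c]] lim2[OF c b] by simp
qed

section \<open>Ladyzhenskaya's inequality and fourth powers\<close>

lemma le_nn_integral_abs_derivative:
  fixes g :: "real \<Rightarrow> real"
  assumes g: "\<And>x. (g has_real_derivative g' x) (at x)"
    and cont: "continuous_on UNIV g'" and zero: "g a = 0" and "a \<le> x"
  shows "ennreal (g x) \<le> (\<integral>\<^sup>+s. ennreal \<bar>g' s\<bar> \<partial>lborel)"
proof -
  have [measurable]: "g' \<in> borel_measurable borel"
    by (rule borel_measurable_continuous_onI[OF cont])
  have isCont: "isCont g' s" for s
    using cont by (simp add: continuous_on_eq_continuous_at)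
  have int: "has_bochner_integral lborel (\<lambda>s. g' s * indicator {a..x} s) (g x - g a)"
    by (rule has_bochner_integral_FTC_Icc_real[OF \<open>a \<le> x\<close> g isCont])
  then have int': "integrable lborel (\<lambda>s. g' s * indicator {a..x} s)"
    by (rule integrable.intros)
  have "g x = (\<integral>s. g' s * indicator {a..x} s \<partial>lborel)"
    using has_bochner_integral_integral_eq[OF int] zero by simp
  also have "\<dots> \<le> (\<integral>s. \<bar>g' s * indicator {a..x} s\<bar> \<partial>lborel)"
    using int' by (intro integral_mono) auto
  finally have "ennreal (g x) \<le> ennreal (\<integral>s. \<bar>g' s * indicator {a..x} s\<bar> \<partial>lborel)"
    by (rule ennreal_leI)
  also have "\<dots> = (\<integral>\<^sup>+s. ennreal \<bar>g' s * indicator {a..x} s\<bar> \<partial>lborel)"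
    by (rule nn_integral_eq_integral[symmetric]) (use int' in auto)
  also have "\<dots> \<le> (\<integral>\<^sup>+s. ennreal \<bar>g' s\<bar> \<partial>lborel)"
    by (intro nn_integral_mono ennreal_leI) (auto simp: indicator_def)
  finally show ?thesis .
qed

text \<open>
  Ladyzhenskaya's argument: \<open>\<phi>\<^sup>2\<close> at a point is bounded by the integral of its partial derivative
  along the horizontal line through the point, and likewise along the vertical line. The product of
  the two bounds depends on \<open>x\<close> through one factor and on \<open>y\<close> through the other, so Tonelli's
  theorem splits its integral.
\<close>

lemma test_function_power4_bound:
  fixes \<phi> :: "real \<times> real \<Rightarrow> real"
  assumes \<phi>: "\<phi> \<in> test_functions S"
  shows "(\<integral>\<^sup>+z. ennreal ((\<phi> z) ^ 4) \<partial>lborel) \<le>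
    (\<integral>\<^sup>+z. ennreal ((\<phi> z)\<^sup>2 + (pdiff (1, 0) \<phi> z)\<^sup>2) \<partial>lborel) *
    (\<integral>\<^sup>+z. ennreal ((\<phi> z)\<^sup>2 + (pdiff (0, 1) \<phi> z)\<^sup>2) \<partial>lborel)"
proof -
  obtain K where K: "compact K" "K \<subseteq> S" "\<And>z. z \<notin> K \<Longrightarrow> \<phi> z = 0"
    using test_function_support[OF \<phi>] by blast
  obtain r where r: "\<And>z. z \<in> K \<Longrightarrow> norm z \<le> r"
    using compact_imp_bounded[OF K(1)] by (auto simp: bounded_iff)
  \<comment> \<open>A starting point on each line that lies outside the support and to the left of, or below, the given point.\<close>
  have far: "\<phi> (- (\<bar>r\<bar> + 1) - \<bar>x\<bar>, y) = 0" "\<phi> (x, - (\<bar>r\<bar> + 1) - \<bar>y\<bar>) = 0" for x y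
    using K(3) r norm_fst_le[of "- (\<bar>r\<bar> + 1) - \<bar>x\<bar>" y] norm_snd_le[of "- (\<bar>r\<bar> + 1) - \<bar>y\<bar>" x]
    by (smt (verit) real_norm_def)+
  have basis: "(1::real, 0::real) \<in> Basis" "(0::real, 1::real) \<in> Basis"
    by (simp_all add: Basis_prod_def)
  have cont: "continuous_on UNIV \<phi>" "continuous_on UNIV (pdiff (1, 0) \<phi>)" "continuous_on UNIV (pdiff (0, 1) \<phi>)"
    using test_function_continuous[OF \<phi>] test_function_continuous[OF pdiff_test_function[OF \<phi> basis(1)]]
      test_function_continuous[OF pdiff_test_function[OF \<phi> basis(2)]] by simp_all
  have meas[measurable]: "\<phi> \<in> borel_measurable borel" "pdiff (1, 0) \<phi> \<in> borel_measurable borel"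
      "pdiff (0, 1) \<phi> \<in> borel_measurable borel"
    by (rule borel_measurable_continuous_onI, rule cont)+
  define f where "f z = \<bar>2 * \<phi> z * pdiff (1, 0) \<phi> z\<bar>" for z
  define g where "g z = \<bar>2 * \<phi> z * pdiff (0, 1) \<phi> z\<bar>" for z
  have [measurable]: "f \<in> borel_measurable borel" "g \<in> borel_measurable borel"
    unfolding f_def[abs_def] g_def[abs_def] by measurable
  have [measurable]: "f \<in> borel_measurable (borel \<Otimes>\<^sub>M borel)" "g \<in> borel_measurable (borel \<Otimes>\<^sub>M borel)"
    "\<phi> \<in> borel_measurable (borel \<Otimes>\<^sub>M borel)"
    by (simp_all add: borel_prod)
  define F where "F y = (\<integral>\<^sup>+s. ennreal (f (s, y)) \<partial>lborel)" for y
  define G where "G x = (\<integral>\<^sup>+t. ennreal (g (x, t)) \<partial>lborel)" for x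
  have [measurable]: "F \<in> borel_measurable borel" "G \<in> borel_measurable borel"
    unfolding F_def[abs_def] G_def[abs_def] by measurable
  have line: "((\<lambda>s. (\<phi> (z + s *\<^sub>R b))\<^sup>2) has_real_derivative
      2 * \<phi> (z + t *\<^sub>R b) * pdiff b \<phi> (z + t *\<^sub>R b)) (at t)" for z b t
  proof -
    have "((\<lambda>s. \<phi> (z + s *\<^sub>R b)) has_real_derivative pdiff b \<phi> (z + t *\<^sub>R b)) (at t)"
      unfolding pdiff_def by (rule has_real_derivative_along_line[OF test_function_has_derivative[OF \<phi>]])
    from DERIV_mult[OF this this] show ?thesis
      unfolding power2_eq_square by (rule DERIV_cong) simp
  qed
  have F: "ennreal ((\<phi> (x, y))\<^sup>2) \<le> F y" for x y
    unfolding F_def f_def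
  proof (rule le_nn_integral_abs_derivative[where g = "\<lambda>s. (\<phi> (s, y))\<^sup>2"])
    show "((\<lambda>s. (\<phi> (s, y))\<^sup>2) has_real_derivative 2 * \<phi> (t, y) * pdiff (1, 0) \<phi> (t, y)) (at t)" for t
      using line[of "(0, y)" "(1, 0)" t] by simp
    show "continuous_on UNIV (\<lambda>s. 2 * \<phi> (s, y) * pdiff (1, 0) \<phi> (s, y))"
      by (intro continuous_intros continuous_on_compose2[OF cont(1)] continuous_on_compose2[OF cont(2)]) auto
    show "(\<phi> (- (\<bar>r\<bar> + 1) - \<bar>x\<bar>, y))\<^sup>2 = 0"
      using far by simp
  qed linarith
  have G: "ennreal ((\<phi> (x, y))\<^sup>2) \<le> G x" for x y
    unfolding G_def g_def
  proof (rule le_nn_integral_abs_derivative[where g = "\<lambda>s. (\<phi> (x, s))\<^sup>2"])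
    show "((\<lambda>s. (\<phi> (x, s))\<^sup>2) has_real_derivative 2 * \<phi> (x, t) * pdiff (0, 1) \<phi> (x, t)) (at t)" for t
      using line[of "(x, 0)" "(0, 1)" t] by simp
    show "continuous_on UNIV (\<lambda>s. 2 * \<phi> (x, s) * pdiff (0, 1) \<phi> (x, s))"
      by (intro continuous_intros continuous_on_compose2[OF cont(1)] continuous_on_compose2[OF cont(3)]) auto
    show "(\<phi> (x, - (\<bar>r\<bar> + 1) - \<bar>y\<bar>))\<^sup>2 = 0"
      using far by simp
  qed linarith
  have "(\<integral>\<^sup>+z. ennreal ((\<phi> z) ^ 4) \<partial>lborel) = (\<integral>\<^sup>+x. \<integral>\<^sup>+y. ennreal ((\<phi> (x, y)) ^ 4) \<partial>lborel \<partial>lborel)"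
    by (subst lborel_prod[symmetric]) (rule lborel.nn_integral_fst[symmetric], measurable)
  also have "\<dots> \<le> (\<integral>\<^sup>+x. \<integral>\<^sup>+y. G x * F y \<partial>lborel \<partial>lborel)"
  proof (intro nn_integral_mono)
    fix x y
    have "ennreal ((\<phi> (x, y)) ^ 4) = ennreal ((\<phi> (x, y))\<^sup>2) * ennreal ((\<phi> (x, y))\<^sup>2)"
      by (simp add: ennreal_mult[symmetric] power2_eq_square power4_eq_xxxx mult.assoc)
    also have "\<dots> \<le> G x * F y"
      by (intro mult_mono F G) auto
    finally show "ennreal ((\<phi> (x, y)) ^ 4) \<le> G x * F y" .
  qed
  also have "\<dots> = (\<integral>\<^sup>+x. G x \<partial>lborel) * (\<integral>\<^sup>+y. F y \<partial>lborel)"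
    by (simp add: nn_integral_cmult nn_integral_multc)
  also have "(\<integral>\<^sup>+x. G x \<partial>lborel) = (\<integral>\<^sup>+z. ennreal (g z) \<partial>lborel)"
    unfolding G_def by (subst lborel_prod[symmetric]) (rule lborel.nn_integral_fst, measurable)
  also have "(\<integral>\<^sup>+y. F y \<partial>lborel) = (\<integral>\<^sup>+z. ennreal (f z) \<partial>lborel)"
    unfolding F_def by (subst lborel_prod[symmetric]) (rule lborel_pair.nn_integral_snd, measurable)
  also have "(\<integral>\<^sup>+z. ennreal (g z) \<partial>lborel) * (\<integral>\<^sup>+z. ennreal (f z) \<partial>lborel) \<le>
      (\<integral>\<^sup>+z. ennreal ((\<phi> z)\<^sup>2 + (pdiff (0, 1) \<phi> z)\<^sup>2) \<partial>lborel) *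
      (\<integral>\<^sup>+z. ennreal ((\<phi> z)\<^sup>2 + (pdiff (1, 0) \<phi> z)\<^sup>2) \<partial>lborel)"
  proof (intro mult_mono nn_integral_mono ennreal_leI)
    have young: "\<bar>2 * a * b\<bar> \<le> a\<^sup>2 + b\<^sup>2" for a b :: real
      using sum_squares_bound[of "\<bar>a\<bar>" "\<bar>b\<bar>"] by (simp add: abs_mult)
    show "f z \<le> (\<phi> z)\<^sup>2 + (pdiff (1, 0) \<phi> z)\<^sup>2" "g z \<le> (\<phi> z)\<^sup>2 + (pdiff (0, 1) \<phi> z)\<^sup>2" for z
      unfolding f_def g_def using young by blast+
  qed auto
  finally show ?thesis
    by (simp add: mult.commute)
qed

text \<open>
  Phrased through \<open>u\<^sup>2\<close>, so that closure properties reduce to those of square integrable functions.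
\<close>

definition quartic_integrable :: "'a::euclidean_space set \<Rightarrow> ('a \<Rightarrow> real) \<Rightarrow> bool" where
  "quartic_integrable S u \<longleftrightarrow> u \<in> borel_measurable (lebesgue_on S) \<and> square_integrable S (\<lambda>x. (u x)\<^sup>2)"

lemma quartic_integrable_mult:
  assumes "quartic_integrable S u" "quartic_integrable S v"
  shows "square_integrable S (\<lambda>x. u x * v x)"
  using assms square_integrable_mult_integrable[of S "\<lambda>x. (u x)\<^sup>2" "\<lambda>x. (v x)\<^sup>2"]
  by (auto simp: quartic_integrable_def square_integrable_def power_mult_distrib)

lemma quartic_integrable_add:
  assumes "quartic_integrable S u" "quartic_integrable S v"
  shows "quartic_integrable S (\<lambda>x. u x + v x)"
proof -
  have "square_integrable S (\<lambda>x. (u x)\<^sup>2 + (v x)\<^sup>2 + 2 * (u x * v x))"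
    using assms by (intro square_integrable_add square_integrable_cmult quartic_integrable_mult)
      (auto simp: quartic_integrable_def)
  then show ?thesis
    using assms by (auto simp: quartic_integrable_def power2_sum mult.assoc)
qed

lemma quartic_integrable_bounded:
  assumes "S \<in> lmeasurable" "u \<in> borel_measurable (lebesgue_on S)" "\<And>x. x \<in> S \<Longrightarrow> \<bar>u x\<bar> \<le> M"
  shows "quartic_integrable S u"
proof -
  have fin: "finite_measure (lebesgue_on S)"
    using assms(1) by (rule finite_measure_lebesgue_on)
  have "integrable (lebesgue_on S) (\<lambda>x. ((u x)\<^sup>2)\<^sup>2)"
  proof (rule finite_measure.integrable_const_bound[OF fin, of _ "(M\<^sup>2)\<^sup>2"])
    have "\<bar>u x\<bar> ^ 4 \<le> M ^ 4" if "x \<in> S" for x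
      using assms(3)[OF that] by (intro power_mono) auto
    then show "AE x in lebesgue_on S. norm (((u x)\<^sup>2)\<^sup>2) \<le> (M\<^sup>2)\<^sup>2"
      by (intro AE_I2) (auto simp: power_mult[symmetric] power_even_abs)
  qed (use assms(2) in measurable)
  then show ?thesis
    using assms(2) by (auto simp: quartic_integrable_def square_integrable_def)
qed

text \<open>
  Ladyzhenskaya's bound is uniform along an approximating sequence of test functions, because the
  Sobolev norms converge. A subsequence converges almost everywhere, and Fatou's lemma carries the
  bound over to the limit.
\<close>

lemma W12_0_quartic_integrable:
  fixes S :: "(real \<times> real) set"
  assumes S: "open S" "bounded S" and u: "u \<in> W12_0 S"
  shows "quartic_integrable S u"
proof -
  let ?M = "lebesgue_on S"
  obtain \<phi> where "W12_limit S \<phi> u"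
    using W12_0_approx[OF S u] by blast
  then have \<phi>: "\<phi> n \<in> test_functions S"
    and lim: "(\<lambda>n. integral\<^sup>L ?M (\<lambda>x. (\<phi> n x - u x)\<^sup>2)) \<longlonglongrightarrow> 0"
    and limD: "b \<in> Basis \<Longrightarrow> (\<lambda>n. integral\<^sup>L ?M (\<lambda>x. (pdiff b (\<phi> n) x - weak_deriv S b u x)\<^sup>2)) \<longlonglongrightarrow> 0"
    for n b
    by (simp_all add: W12_limit_def)
  have uW: "u \<in> W12 S" using u by (rule W12_0_W12)
  have S_borel: "S \<in> sets borel" using S by simp
  note u2 = W12_square_integrable[OF uW]
  have [measurable]: "u \<in> borel_measurable ?M"
    using u2 by (simp add: square_integrable_def)
  have \<phi>2: "square_integrable S (\<phi> n)" "b \<in> Basis \<Longrightarrow> square_integrable S (pdiff b (\<phi> n))" for n b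
    using test_function_square_integrable[OF _ S_borel] \<phi> pdiff_test_function by blast+
  have [measurable]: "\<phi> n \<in> borel_measurable ?M" for n
    using \<phi>2(1) by (simp add: square_integrable_def)
  have energy_bound: "\<exists>B\<ge>0. \<forall>n. (\<integral>\<^sup>+z. ennreal ((\<phi> n z)\<^sup>2 + (pdiff b (\<phi> n) z)\<^sup>2) \<partial>lborel) \<le> ennreal B"
    if b: "b \<in> Basis" for b
  proof -
    let ?E = "\<lambda>n. integral\<^sup>L ?M (\<lambda>z. (\<phi> n z)\<^sup>2) + integral\<^sup>L ?M (\<lambda>z. (pdiff b (\<phi> n) z)\<^sup>2)"
    have "convergent ?E"
      using tendsto_add[OF tendsto_integral_power2_L2[OF \<phi>2(1) u2 lim]
          tendsto_integral_power2_L2[OF \<phi>2(2)[OF b] W12_weak_deriv_square_integrable[OF uW b] limD[OF b]]]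
      by (auto simp: convergent_def)
    from convergent_imp_Bseq[OF this] obtain B where B: "B > 0" "\<forall>n. norm (?E n) \<le> B"
      by (rule BseqE)
    have "(\<integral>\<^sup>+z. ennreal ((\<phi> n z)\<^sup>2 + (pdiff b (\<phi> n) z)\<^sup>2) \<partial>lborel) \<le> ennreal B" for n
    proof -
      obtain K where K: "compact K" "K \<subseteq> S" "\<And>z. z \<notin> K \<Longrightarrow> \<phi> n z = 0"
        using test_function_support[OF \<phi>] by blast
      have D0: "pdiff b (\<phi> n) z = 0" if "z \<notin> K" for z
        unfolding pdiff_def
        using directional_derivative_outside_support[OF test_function_has_derivative[OF \<phi>] K(1,3) that] .
      let ?e = "\<lambda>z. (\<phi> n z)\<^sup>2 + (pdiff b (\<phi> n) z)\<^sup>2"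
      have e_cont: "continuous_on UNIV ?e"
        by (intro continuous_intros test_function_continuous[OF \<phi>]
            test_function_continuous[OF pdiff_test_function[OF \<phi> b]])
      have e_0: "?e z = 0" if "z \<notin> K" for z
        using K(3)[OF that] D0[OF that] by simp
      then have e_0': "?e z = 0" if "z \<notin> S" for z
        using that K(2) by (meson subsetD)
      have "(\<integral>\<^sup>+z. ennreal (?e z) \<partial>lborel) = ennreal (integral\<^sup>L lborel ?e)"
        using integrable_lborel_continuous_compact_support[OF e_cont K(1) e_0]
        by (intro nn_integral_eq_integral) auto
      also have "integral\<^sup>L lborel ?e = integral\<^sup>L ?M ?e"
        by (rule integral_lebesgue_on_eq_lborel(1)[symmetric,
              OF borel_measurable_continuous_onI[OF e_cont] S_borel e_0'])
      also have "\<dots> = ?E n"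
        using \<phi>2 b by (simp add: square_integrable_def)
      also have "ennreal (?E n) \<le> ennreal B"
        using B(2)[rule_format, of n] by (intro ennreal_leI) simp
      finally show ?thesis .
    qed
    then show ?thesis
      using B(1) by (intro exI[of _ B]) auto
  qed
  have basis: "(1::real, 0::real) \<in> Basis" "(0::real, 1::real) \<in> Basis"
    by (simp_all add: Basis_prod_def)
  obtain B1 where B1: "B1 \<ge> 0"
    "\<forall>n. (\<integral>\<^sup>+z. ennreal ((\<phi> n z)\<^sup>2 + (pdiff (1, 0) (\<phi> n) z)\<^sup>2) \<partial>lborel) \<le> ennreal B1"
    using energy_bound[OF basis(1)] by blast
  obtain B2 where B2: "B2 \<ge> 0"
    "\<forall>n. (\<integral>\<^sup>+z. ennreal ((\<phi> n z)\<^sup>2 + (pdiff (0, 1) (\<phi> n) z)\<^sup>2) \<partial>lborel) \<le> ennreal B2"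
    using energy_bound[OF basis(2)] by blast
  have bound: "(\<integral>\<^sup>+z. ennreal ((\<phi> n z) ^ 4) \<partial>?M) \<le> ennreal (B1 * B2)" for n
  proof -
    have [measurable]: "\<phi> n \<in> borel_measurable borel"
      by (rule borel_measurable_continuous_onI[OF test_function_continuous[OF \<phi>]])
    have "(\<integral>\<^sup>+z. ennreal ((\<phi> n z) ^ 4) \<partial>?M) = (\<integral>\<^sup>+z. ennreal ((\<phi> n z) ^ 4) * indicator S z \<partial>lebesgue)"
      using S by (simp add: nn_integral_restrict_space)
    also have "\<dots> \<le> (\<integral>\<^sup>+z. ennreal ((\<phi> n z) ^ 4) \<partial>lebesgue)"
      by (intro nn_integral_mono) (auto simp: indicator_def)
    also have "\<dots> = (\<integral>\<^sup>+z. ennreal ((\<phi> n z) ^ 4) \<partial>lborel)"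
      by (rule nn_integral_completion)
    also have "\<dots> \<le> ennreal B1 * ennreal B2"
      by (rule order_trans[OF test_function_power4_bound[OF \<phi>] mult_mono[OF B1(2)[rule_format] B2(2)[rule_format]]]) auto
    finally show ?thesis
      using B1 B2 by (simp add: ennreal_mult)
  qed
  have "integrable ?M (\<lambda>x. (\<phi> n x - u x)\<^sup>2)" for n
    using square_integrable_diff[OF \<phi>2(1)[of n] u2] by (simp add: square_integrable_def)
  moreover have "(\<lambda>n. \<integral>x. norm ((\<phi> n x - u x)\<^sup>2) \<partial>?M) \<longlonglongrightarrow> 0"
    using lim by simp
  ultimately obtain r :: "nat \<Rightarrow> nat" where r: "AE x in ?M. (\<lambda>n. (\<phi> (r n) x - u x)\<^sup>2) \<longlonglongrightarrow> 0"
    using tendsto_L1_AE_subseq[where u = "\<lambda>n x. (\<phi> n x - u x)\<^sup>2"] by blast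
  have conv: "AE x in ?M. (\<lambda>n. \<phi> (r n) x) \<longlonglongrightarrow> u x"
    using r by eventually_elim (simp add: power_tendsto_0_iff LIM_zero_iff)
  have "(\<integral>\<^sup>+x. ennreal ((u x) ^ 4) \<partial>?M) = (\<integral>\<^sup>+x. liminf (\<lambda>n. ennreal ((\<phi> (r n) x) ^ 4)) \<partial>?M)"
  proof (rule nn_integral_cong_AE)
    show "AE x in ?M. ennreal ((u x) ^ 4) = liminf (\<lambda>n. ennreal ((\<phi> (r n) x) ^ 4))"
      using conv
    proof eventually_elim
      case (elim x)
      then have "(\<lambda>n. ennreal ((\<phi> (r n) x) ^ 4)) \<longlonglongrightarrow> ennreal ((u x) ^ 4)"
        by (intro tendsto_ennrealI tendsto_power)
      then show ?case
        using lim_imp_Liminf[OF sequentially_bot] by metis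
    qed
  qed
  also have "\<dots> \<le> liminf (\<lambda>n. \<integral>\<^sup>+x. ennreal ((\<phi> (r n) x) ^ 4) \<partial>?M)"
    by (rule nn_integral_liminf) measurable
  also have "\<dots> \<le> ennreal (B1 * B2)"
    by (rule order_trans[OF Liminf_le_Limsup Limsup_bounded]) (auto intro!: always_eventually bound)
  finally have "(\<integral>\<^sup>+x. ennreal ((u x) ^ 4) \<partial>?M) < \<infinity>"
    using ennreal_less_top le_less_trans by fastforce
  then have "integrable ?M (\<lambda>x. (u x) ^ 4)"
    by (intro integrableI_nonneg) auto
  then show ?thesis
    by (auto simp: quartic_integrable_def square_integrable_def power_mult[symmetric])
qed

lemma has_boundary_values_quartic_integrable:
  fixes S :: "(real \<times> real) set"
  assumes S: "open S" "bounded S" and u: "has_boundary_values S u g"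
  shows "quartic_integrable S u"
proof -
  obtain G where G: "G \<in> W12 S" "continuous_on (closure S) G" "(\<lambda>x. u x - G x) \<in> W12_0 S"
    using u by (auto simp: has_boundary_values_def)
  have "compact (closure S)"
    using S by (simp add: compact_closure)
  then have "bounded (G ` closure S)"
    using G(2) compact_continuous_image compact_imp_bounded by blast
  then obtain M where "\<And>x. x \<in> closure S \<Longrightarrow> \<bar>G x\<bar> \<le> M"
    by (auto simp: bounded_iff)
  then have "quartic_integrable S G"
    using S W12_square_integrable[OF G(1)] closure_subset[of S]
    by (intro quartic_integrable_bounded[where M = M]) (auto simp: lmeasurable_open square_integrable_def)
  from quartic_integrable_add[OF W12_0_quartic_integrable[OF S G(3)] this] show ?thesis
    by simp
qed

section \<open>The second derivative of the bulk density\<close>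

text \<open>
  The second derivative of \<open>f_b\<close> at \<open>q\<close> in direction \<open>v\<close>; that it deserves the name is the
  content of \<open>f_b_quartic_expansion\<close>.
\<close>

definition d2f_b :: "real \<Rightarrow> real \<Rightarrow> real \<Rightarrow> real \<Rightarrow> real \<Rightarrow> real \<Rightarrow> real \<Rightarrow> real \<Rightarrow> real \<Rightarrow> real" where
  "d2f_b A B C q1 q2 q3 v1 v2 v3 =
     2 * A * (v1\<^sup>2 + v2\<^sup>2 + 3 * v3\<^sup>2)
     + 8 * C * (q1 * v1 + q2 * v2 + 3 * q3 * v3)\<^sup>2
     + 4 * C * (q1\<^sup>2 + q2\<^sup>2 + 3 * q3\<^sup>2) * (v1\<^sup>2 + v2\<^sup>2 + 3 * v3\<^sup>2)
     + 4 * B * (q3 * (v1\<^sup>2 + v2\<^sup>2 - v3\<^sup>2) + 2 * v3 * (q1 * v1 + q2 * v2 - q3 * v3))"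

text \<open>
  Absorbs the indefinite term of the bulk density: with \<open>x = q3\<close> for perturbations of \<open>q1\<close> and
  \<open>q2\<close>, and with \<open>x = - 3 q3\<close> for perturbations of \<open>q3\<close>.
\<close>

lemma quadratic_lower_bound:
  fixes B C x :: real
  assumes "C > 0"
  shows "- (B\<^sup>2 / (3 * C)) \<le> 12 * C * x\<^sup>2 + 4 * B * x"
proof -
  have "12 * C * x\<^sup>2 + 4 * B * x + B\<^sup>2 / (3 * C) = (6 * C * x + B)\<^sup>2 / (3 * C)"
    using assms by (simp add: field_simps power2_eq_square)
  also have "\<dots> \<ge> 0"
    using assms by simp
  finally show ?thesis by linarith
qed

lemma d2f_b_12_lower_bound:
  assumes "A < 0" "C > 0"
  shows "- (2 * \<bar>A\<bar> + B\<^sup>2 / (3 * C)) * (v1\<^sup>2 + v2\<^sup>2) \<le> d2f_b A B C q1 q2 q3 v1 v2 0"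
proof -
  let ?m = "v1\<^sup>2 + v2\<^sup>2"
  have "- (2 * \<bar>A\<bar> + B\<^sup>2 / (3 * C)) * ?m \<le> (2 * A + (12 * C * q3\<^sup>2 + 4 * B * q3)) * ?m"
    using assms quadratic_lower_bound[of C B q3] by (intro mult_right_mono) auto
  also have "\<dots> \<le> d2f_b A B C q1 q2 q3 v1 v2 0"
  proof -
    have "0 \<le> 8 * C * (q1 * v1 + q2 * v2)\<^sup>2 + 4 * C * (q1\<^sup>2 + q2\<^sup>2) * ?m"
      using assms by simp
    then show ?thesis
      by (simp add: d2f_b_def algebra_simps)
  qed
  finally show ?thesis .
qed

lemma d2f_b_3_lower_bound:
  assumes "A < 0" "C > 0"
  shows "- (6 * \<bar>A\<bar> + B\<^sup>2 / (3 * C)) * v3\<^sup>2 \<le> d2f_b A B C q1 q2 q3 0 0 v3"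
proof -
  have "- (B\<^sup>2 / (3 * C)) \<le> 12 * C * (- 3 * q3)\<^sup>2 + 4 * B * (- 3 * q3)"
    by (rule quadratic_lower_bound[OF assms(2)])
  then have "- (6 * \<bar>A\<bar> + B\<^sup>2 / (3 * C)) * v3\<^sup>2 \<le> (6 * A + (108 * C * q3\<^sup>2 - 12 * B * q3)) * v3\<^sup>2"
    using assms by (intro mult_right_mono) (auto simp: power_mult_distrib)
  also have "\<dots> \<le> d2f_b A B C q1 q2 q3 0 0 v3"
  proof -
    have "0 \<le> 12 * C * (q1\<^sup>2 + q2\<^sup>2) * v3\<^sup>2"
      using assms by simp
    then show ?thesis
      by (simp add: d2f_b_def algebra_simps power2_eq_square)
  qed
  finally show ?thesis .
qed

section \<open>Expansion of the energy along a line\<close>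

lemma f_b_quartic_expansion:
  "f_b A B C (q1 + t * v1) (q2 + t * v2) (q3 + t * v3) =
     f_b A B C q1 q2 q3 + df_b A B C q1 q2 q3 v1 v2 v3 * t + d2f_b A B C q1 q2 q3 v1 v2 v3 / 2 * t\<^sup>2
     + (4 * C * (q1 * v1 + q2 * v2 + 3 * q3 * v3) * (v1\<^sup>2 + v2\<^sup>2 + 3 * v3\<^sup>2)
        + 2 * B * v3 * (v1\<^sup>2 + v2\<^sup>2 - v3\<^sup>2)) * t ^ 3
     + C * (v1\<^sup>2 + v2\<^sup>2 + 3 * v3\<^sup>2)\<^sup>2 * t ^ 4"
proof -
  have 1: "(q1 + t * v1)\<^sup>2 + (q2 + t * v2)\<^sup>2 + 3 * (q3 + t * v3)\<^sup>2 =
      (q1\<^sup>2 + q2\<^sup>2 + 3 * q3\<^sup>2) + 2 * t * (q1 * v1 + q2 * v2 + 3 * q3 * v3) + t\<^sup>2 * (v1\<^sup>2 + v2\<^sup>2 + 3 * v3\<^sup>2)"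
    by algebra
  have 2: "(q1 + t * v1)\<^sup>2 + (q2 + t * v2)\<^sup>2 - (q3 + t * v3)\<^sup>2 =
      (q1\<^sup>2 + q2\<^sup>2 - q3\<^sup>2) + 2 * t * (q1 * v1 + q2 * v2 - q3 * v3) + t\<^sup>2 * (v1\<^sup>2 + v2\<^sup>2 - v3\<^sup>2)"
    by algebra
  have d: "df_b A B C q1 q2 q3 v1 v2 v3 =
      (2 * A + 4 * C * (q1\<^sup>2 + q2\<^sup>2 + 3 * q3\<^sup>2)) * (q1 * v1 + q2 * v2 + 3 * q3 * v3)
      + 2 * B * (v3 * (q1\<^sup>2 + q2\<^sup>2 - q3\<^sup>2) + 2 * q3 * (q1 * v1 + q2 * v2 - q3 * v3))"
    unfolding df_b_def by algebra
  show ?thesis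
    unfolding d f_b_def 1 2 d2f_b_def
    by algebra
qed

lemma f_el_quadratic_expansion:
  "f_el L2 (a1 + t * b1) (a2 + t * b2) (a3 + t * b3) (a4 + t * b4) (a5 + t * b5) (a6 + t * b6) =
     f_el L2 a1 a2 a3 a4 a5 a6 + df_el L2 a1 a2 a3 a4 a5 a6 b1 b2 b3 b4 b5 b6 * t
     + f_el L2 b1 b2 b3 b4 b5 b6 * t\<^sup>2"
  unfolding f_el_def df_el_def by (simp add: algebra_simps power2_eq_square)

lemma has_second_deriv_at_0_quartic:
  fixes a0 a1 a2 a3 a4 :: real
  shows "has_second_deriv_at_0 (\<lambda>t. a0 + a1 * t + a2 * t\<^sup>2 + a3 * t ^ 3 + a4 * t ^ 4) (2 * a2)"
  unfolding has_second_deriv_at_0_def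
proof (intro exI conjI always_eventually allI)
  show "((\<lambda>t. a0 + a1 * t + a2 * t\<^sup>2 + a3 * t ^ 3 + a4 * t ^ 4) has_real_derivative
      a1 + 2 * a2 * t + 3 * a3 * t\<^sup>2 + 4 * a4 * t ^ 3) (at t)" for t
    by (rule derivative_eq_intros refl | simp)+
  show "((\<lambda>t. a1 + 2 * a2 * t + 3 * a3 * t\<^sup>2 + 4 * a4 * t ^ 3) has_real_derivative 2 * a2) (at 0)"
    by (rule derivative_eq_intros refl | simp)+
qed

lemma integrable_f_el:
  assumes "square_integrable S a1" "square_integrable S a2" "square_integrable S a3"
    "square_integrable S a4" "square_integrable S a5" "square_integrable S a6"
  shows "integrable (lebesgue_on S) (\<lambda>x. f_el L2 (a1 x) (a2 x) (a3 x) (a4 x) (a5 x) (a6 x))"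
  unfolding f_el_def power2_eq_square using assms
  by (intro Bochner_Integration.integrable_add Bochner_Integration.integrable_diff integrable_mult_right
      square_integrable_mult_integrable)

lemma integrable_df_el:
  assumes "square_integrable S a1" "square_integrable S a2" "square_integrable S a3"
    "square_integrable S a4" "square_integrable S a5" "square_integrable S a6"
    "square_integrable S b1" "square_integrable S b2" "square_integrable S b3"
    "square_integrable S b4" "square_integrable S b5" "square_integrable S b6"
  shows "integrable (lebesgue_on S)
    (\<lambda>x. df_el L2 (a1 x) (a2 x) (a3 x) (a4 x) (a5 x) (a6 x) (b1 x) (b2 x) (b3 x) (b4 x) (b5 x) (b6 x))"
  unfolding df_el_def using assms
  by (intro Bochner_Integration.integrable_add Bochner_Integration.integrable_diff integrable_mult_right
      square_integrable_mult_integrable square_integrable_add square_integrable_diff)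

text \<open>
  The integrand of the second derivative of \<open>J\<close>; the elastic part is quadratic, so its second
  derivative is \<open>2 f_el\<close> of the gradient of \<open>v\<close>.
\<close>

definition second_variation :: "real \<Rightarrow> real \<Rightarrow> real \<Rightarrow> real \<Rightarrow> real \<Rightarrow> real \<Rightarrow> (real \<times> real) set \<Rightarrow>
    field \<Rightarrow> field \<Rightarrow> field \<Rightarrow> field \<Rightarrow> field \<Rightarrow> field \<Rightarrow> field" where
  "second_variation A B C L lam L2 S q1 q2 q3 v1 v2 v3 = (\<lambda>p.
     2 * f_el L2 (Dx S v1 p) (Dy S v1 p) (Dx S v2 p) (Dy S v2 p) (Dx S v3 p) (Dy S v3 p)
     + lam\<^sup>2 / L * d2f_b A B C (q1 p) (q2 p) (q3 p) (v1 p) (v2 p) (v3 p))"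

text \<open>
  Almost everywhere the weak derivatives depend affinely on \<open>t\<close>, so the integrand of \<open>J\<close> is a
  polynomial in \<open>t\<close> of degree four. Its coefficients are sums of products of at most two square
  integrable functions: the gradients, the components of \<open>q\<close> and \<open>v\<close>, and the quadratic expressions in \<open>q\<close> and \<open>v\<close> that appear below.
\<close>

lemma second_variation_J:
  fixes S :: "(real \<times> real) set"
  assumes S: "open S" "bounded S"
    and q: "q1 \<in> W12 S" "q2 \<in> W12 S" "q3 \<in> W12 S"
    and v: "v1 \<in> W12 S" "v2 \<in> W12 S" "v3 \<in> W12 S"
    and q4: "quartic_integrable S q1" "quartic_integrable S q2" "quartic_integrable S q3"
    and v4: "quartic_integrable S v1" "quartic_integrable S v2" "quartic_integrable S v3"
  shows "integrable (lebesgue_on S) (second_variation A B C L lam L2 S q1 q2 q3 v1 v2 v3)"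
    and "has_second_deriv_at_0 (\<lambda>t. J A B C L lam L2 S (\<lambda>p. q1 p + t * v1 p) (\<lambda>p. q2 p + t * v2 p)
      (\<lambda>p. q3 p + t * v3 p))
      (integral\<^sup>L (lebesgue_on S) (second_variation A B C L lam L2 S q1 q2 q3 v1 v2 v3))"
proof -
  let ?D2 = "second_variation A B C L lam L2 S q1 q2 q3 v1 v2 v3"
  let ?M = "lebesgue_on S" and ?\<kappa> = "lam\<^sup>2 / L"
  have basis: "(1::real, 0::real) \<in> Basis" "(0::real, 1::real) \<in> Basis"
    by (simp_all add: Basis_prod_def)
  have Slm: "S \<in> lmeasurable"
    using S by (simp add: lmeasurable_open)
  note Dq = q[THEN W12_weak_deriv_square_integrable, OF basis(1)] q[THEN W12_weak_deriv_square_integrable, OF basis(2)]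
  note Dv = v[THEN W12_weak_deriv_square_integrable, OF basis(1)] v[THEN W12_weak_deriv_square_integrable, OF basis(2)]
  note L2s = q[THEN W12_square_integrable] v[THEN W12_square_integrable]
  note sq_intros = square_integrable_add square_integrable_diff square_integrable_cmult quartic_integrable_mult q4 v4 L2s
  define \<rho> where "\<rho> p = q1 p * q1 p + q2 p * q2 p + 3 * (q3 p * q3 p)" for p
  define \<sigma> where "\<sigma> p = q1 p * q1 p + q2 p * q2 p - q3 p * q3 p" for p
  define n where "n p = q1 p * v1 p + q2 p * v2 p + 3 * (q3 p * v3 p)" for p
  define \<sigma>1 where "\<sigma>1 p = q1 p * v1 p + q2 p * v2 p - q3 p * v3 p" for p
  define m where "m p = v1 p * v1 p + v2 p * v2 p + 3 * (v3 p * v3 p)" for p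
  define \<sigma>2 where "\<sigma>2 p = v1 p * v1 p + v2 p * v2 p - v3 p * v3 p" for p
  have sq: "square_integrable S \<rho>" "square_integrable S \<sigma>" "square_integrable S n" "square_integrable S \<sigma>1"
      "square_integrable S m" "square_integrable S \<sigma>2"
    unfolding \<rho>_def[abs_def] \<sigma>_def[abs_def] n_def[abs_def] \<sigma>1_def[abs_def] m_def[abs_def] \<sigma>2_def[abs_def]
    by (intro sq_intros)+
  note int_intros = Bochner_Integration.integrable_add integrable_mult_right square_integrable_mult_integrable
    square_integrable_imp_integrable[OF _ Slm] sq L2s
  define c0 where "c0 p = f_b A B C (q1 p) (q2 p) (q3 p)" for p
  define c1 where "c1 p = df_b A B C (q1 p) (q2 p) (q3 p) (v1 p) (v2 p) (v3 p)" for p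
  define c2 where "c2 p = d2f_b A B C (q1 p) (q2 p) (q3 p) (v1 p) (v2 p) (v3 p) / 2" for p
  define c3 where "c3 p = 4 * C * (q1 p * v1 p + q2 p * v2 p + 3 * q3 p * v3 p) * ((v1 p)\<^sup>2 + (v2 p)\<^sup>2 + 3 * (v3 p)\<^sup>2)
        + 2 * B * v3 p * ((v1 p)\<^sup>2 + (v2 p)\<^sup>2 - (v3 p)\<^sup>2)" for p
  define c4 where "c4 p = C * ((v1 p)\<^sup>2 + (v2 p)\<^sup>2 + 3 * (v3 p)\<^sup>2)\<^sup>2" for p
  have c_eq: "c0 = (\<lambda>p. A * \<rho> p + C * (\<rho> p * \<rho> p) + 2 * B * (q3 p * \<sigma> p))"
      "c1 = (\<lambda>p. 2 * A * n p + 4 * C * (\<rho> p * n p) + 2 * B * (v3 p * \<sigma> p) + 4 * B * (q3 p * \<sigma>1 p))"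
      "c2 = (\<lambda>p. A * m p + 4 * C * (n p * n p) + 2 * C * (\<rho> p * m p) + 2 * B * (q3 p * \<sigma>2 p) + 4 * B * (v3 p * \<sigma>1 p))"
      "c3 = (\<lambda>p. 4 * C * (n p * m p) + 2 * B * (v3 p * \<sigma>2 p))"
      "c4 = (\<lambda>p. C * (m p * m p))"
    unfolding c0_def c1_def c2_def c3_def c4_def f_b_def df_b_def d2f_b_def \<rho>_def \<sigma>_def n_def \<sigma>1_def m_def \<sigma>2_def
    by (rule ext, algebra)+
  have c_int: "integrable ?M c0" "integrable ?M c1" "integrable ?M c2" "integrable ?M c3" "integrable ?M c4"
    unfolding c_eq by (intro int_intros)+
  define e0 where "e0 p = f_el L2 (Dx S q1 p) (Dy S q1 p) (Dx S q2 p) (Dy S q2 p) (Dx S q3 p) (Dy S q3 p)" for p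
  define e1 where "e1 p = df_el L2 (Dx S q1 p) (Dy S q1 p) (Dx S q2 p) (Dy S q2 p) (Dx S q3 p) (Dy S q3 p)
    (Dx S v1 p) (Dy S v1 p) (Dx S v2 p) (Dy S v2 p) (Dx S v3 p) (Dy S v3 p)" for p
  define e2 where "e2 p = f_el L2 (Dx S v1 p) (Dy S v1 p) (Dx S v2 p) (Dy S v2 p) (Dx S v3 p) (Dy S v3 p)" for p
  have e_int: "integrable ?M e0" "integrable ?M e1" "integrable ?M e2"
    unfolding e0_def[abs_def] e1_def[abs_def] e2_def[abs_def]
    by (intro integrable_f_el integrable_df_el Dq Dv)+
  have D2_eq: "?D2 = (\<lambda>p. 2 * (e2 p + ?\<kappa> * c2 p))"
    by (simp add: second_variation_def e2_def c2_def fun_eq_iff)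
  show "integrable ?M ?D2"
    unfolding D2_eq by (intro int_intros e_int c_int)
  let ?I = "integral\<^sup>L ?M"
  have J_eq: "J A B C L lam L2 S (\<lambda>p. q1 p + t * v1 p) (\<lambda>p. q2 p + t * v2 p) (\<lambda>p. q3 p + t * v3 p) =
      (?I e0 + ?\<kappa> * ?I c0) + (?I e1 + ?\<kappa> * ?I c1) * t + (?I e2 + ?\<kappa> * ?I c2) * t\<^sup>2
      + (?\<kappa> * ?I c3) * t ^ 3 + (?\<kappa> * ?I c4) * t ^ 4" for t
  proof -
    have W: "(\<lambda>p. q1 p + t * v1 p) \<in> W12 S" "(\<lambda>p. q2 p + t * v2 p) \<in> W12 S" "(\<lambda>p. q3 p + t * v3 p) \<in> W12 S"
      using q v S(1) by (auto intro: W12_add_cmult)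
    note DW = W[THEN W12_weak_deriv_square_integrable, OF basis(1)] W[THEN W12_weak_deriv_square_integrable, OF basis(2)]
    have AE_D: "AE p in ?M. weak_deriv S b (\<lambda>p. u p + t * w p) p = weak_deriv S b u p + t * weak_deriv S b w p"
      if "b \<in> Basis" "u \<in> W12 S" "w \<in> W12 S" for b u w
      using weak_deriv_add_cmult[OF S that] .
    define P where "P p = e0 p + e1 p * t + e2 p * t\<^sup>2
      + ?\<kappa> * (c0 p + c1 p * t + c2 p * t\<^sup>2 + c3 p * t ^ 3 + c4 p * t ^ 4)" for p
    have P_int: "integrable ?M P"
      unfolding P_def[abs_def] using e_int c_int by auto
    have f_b_eq: "f_b A B C (q1 p + t * v1 p) (q2 p + t * v2 p) (q3 p + t * v3 p) =
        c0 p + c1 p * t + c2 p * t\<^sup>2 + c3 p * t ^ 3 + c4 p * t ^ 4" for p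
      unfolding c0_def c1_def c2_def c3_def c4_def by (rule f_b_quartic_expansion)
    have "J A B C L lam L2 S (\<lambda>p. q1 p + t * v1 p) (\<lambda>p. q2 p + t * v2 p) (\<lambda>p. q3 p + t * v3 p) = ?I P"
      unfolding J_def
    proof (rule integral_cong_AE)
      show "P \<in> borel_measurable ?M"
        using P_int by (rule borel_measurable_integrable)
      show "(\<lambda>p. f_el L2 (Dx S (\<lambda>p. q1 p + t * v1 p) p) (Dy S (\<lambda>p. q1 p + t * v1 p) p)
          (Dx S (\<lambda>p. q2 p + t * v2 p) p) (Dy S (\<lambda>p. q2 p + t * v2 p) p)
          (Dx S (\<lambda>p. q3 p + t * v3 p) p) (Dy S (\<lambda>p. q3 p + t * v3 p) p) +
          ?\<kappa> * f_b A B C (q1 p + t * v1 p) (q2 p + t * v2 p) (q3 p + t * v3 p)) \<in> borel_measurable ?M"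
      proof (rule borel_measurable_integrable, rule Bochner_Integration.integrable_add)
        show "integrable ?M (\<lambda>p. f_el L2 (Dx S (\<lambda>p. q1 p + t * v1 p) p) (Dy S (\<lambda>p. q1 p + t * v1 p) p)
          (Dx S (\<lambda>p. q2 p + t * v2 p) p) (Dy S (\<lambda>p. q2 p + t * v2 p) p)
          (Dx S (\<lambda>p. q3 p + t * v3 p) p) (Dy S (\<lambda>p. q3 p + t * v3 p) p))"
          by (intro integrable_f_el DW)
        show "integrable ?M (\<lambda>p. ?\<kappa> * f_b A B C (q1 p + t * v1 p) (q2 p + t * v2 p) (q3 p + t * v3 p))"
          unfolding f_b_eq using c_int by auto
      qed
      show "AE p in ?M. f_el L2 (Dx S (\<lambda>p. q1 p + t * v1 p) p) (Dy S (\<lambda>p. q1 p + t * v1 p) p)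
          (Dx S (\<lambda>p. q2 p + t * v2 p) p) (Dy S (\<lambda>p. q2 p + t * v2 p) p)
          (Dx S (\<lambda>p. q3 p + t * v3 p) p) (Dy S (\<lambda>p. q3 p + t * v3 p) p) +
          ?\<kappa> * f_b A B C (q1 p + t * v1 p) (q2 p + t * v2 p) (q3 p + t * v3 p) = P p"
        using AE_D[OF basis(1) q(1) v(1)] AE_D[OF basis(1) q(2) v(2)] AE_D[OF basis(1) q(3) v(3)]
          AE_D[OF basis(2) q(1) v(1)] AE_D[OF basis(2) q(2) v(2)] AE_D[OF basis(2) q(3) v(3)]
      proof eventually_elim
        case (elim p)
        show ?case
          unfolding elim f_el_quadratic_expansion f_b_eq P_def e0_def e1_def e2_def ..
      qed
    qed
    also have "?I P = ?I (\<lambda>p. e0 p + e1 p * t + e2 p * t\<^sup>2)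
        + ?\<kappa> * ?I (\<lambda>p. c0 p + c1 p * t + c2 p * t\<^sup>2 + c3 p * t ^ 3 + c4 p * t ^ 4)"
      unfolding P_def[abs_def] using e_int c_int by simp
    also have "\<dots> = (?I e0 + ?\<kappa> * ?I c0) + (?I e1 + ?\<kappa> * ?I c1) * t + (?I e2 + ?\<kappa> * ?I c2) * t\<^sup>2
      + (?\<kappa> * ?I c3) * t ^ 3 + (?\<kappa> * ?I c4) * t ^ 4"
      using e_int c_int by (simp add: algebra_simps)
    finally show ?thesis .
  qed
  have "?I ?D2 = 2 * (?I e2 + ?\<kappa> * ?I c2)"
    unfolding D2_eq using e_int c_int by simp
  note I_D2 = this
  show "has_second_deriv_at_0 (\<lambda>t. J A B C L lam L2 S (\<lambda>p. q1 p + t * v1 p) (\<lambda>p. q2 p + t * v2 p)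
      (\<lambda>p. q3 p + t * v3 p)) (?I ?D2)"
    unfolding J_eq I_D2 by (rule has_second_deriv_at_0_quartic)
qed

lemma integral_power2_pos:
  assumes "square_integrable S u" "\<not> (AE x in lebesgue_on S. u x = 0)"
  shows "0 < integral\<^sup>L (lebesgue_on S) (\<lambda>x. (u x)\<^sup>2)"
proof -
  have "integral\<^sup>L (lebesgue_on S) (\<lambda>x. (u x)\<^sup>2) \<noteq> 0"
    using assms by (subst integral_nonneg_eq_0_iff_AE) (auto simp: square_integrable_def)
  moreover have "integral\<^sup>L (lebesgue_on S) (\<lambda>x. (u x)\<^sup>2) \<ge> 0"
    by simp
  ultimately show ?thesis by linarith
qed

section \<open>Positivity of the second variation\<close>

text \<open>
  The Jacobian term drops out after integration, the bulk term costs at most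
  \<open>lam\<^sup>2 / L * (2 \<bar>A\<bar> + B\<^sup>2 / (3 C)) * \<integral>\<bar>v\<bar>\<^sup>2\<close>, and the Poincare inequality with \<open>R = 1\<close> bounds
  the last integral by \<open>4\<close> times the Dirichlet integral, which \<open>L2\<close> times the Dirichlet integral
  outweighs.
\<close>

lemma second_variation_12_pos:
  fixes S :: "(real \<times> real) set"
  assumes S: "open S" "bounded S" and strip: "\<And>x y. (x, y) \<in> S \<Longrightarrow> \<bar>x\<bar> \<le> 1"
    and "A < 0" "C > 0" "L > 0"
    and L2: "lam\<^sup>2 / L * (4 * (2 * \<bar>A\<bar> + B\<^sup>2 / (3 * C))) \<le> L2"
    and v: "v1 \<in> W12_0 S" "v2 \<in> W12_0 S"
    and nz: "\<not> (is_zero_on S v1 \<and> is_zero_on S v2)"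
    and int: "integrable (lebesgue_on S) (second_variation A B C L lam L2 S q1 q2 q3 v1 v2 (\<lambda>p. 0))"
  shows "0 < integral\<^sup>L (lebesgue_on S) (second_variation A B C L lam L2 S q1 q2 q3 v1 v2 (\<lambda>p. 0))"
proof -
  let ?M = "lebesgue_on S" and ?\<kappa> = "lam\<^sup>2 / L" and ?K = "2 * \<bar>A\<bar> + B\<^sup>2 / (3 * C)"
  let ?I = "integral\<^sup>L ?M"
  have basis: "(1::real, 0::real) \<in> Basis" "(0::real, 1::real) \<in> Basis"
    by (simp_all add: Basis_prod_def)
  have strip': "\<bar>z \<bullet> (1, 0)\<bar> \<le> 1" if "z \<in> S" for z
    using that strip[of "fst z" "snd z"] by (simp add: inner_prod_def)
  have W: "v1 \<in> W12 S" "v2 \<in> W12 S"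
    using v by (auto intro: W12_0_W12)
  note L2v = W[THEN W12_square_integrable]
  note Dv = W[THEN W12_weak_deriv_square_integrable, OF basis(1)] W[THEN W12_weak_deriv_square_integrable, OF basis(2)]
  have sq_int: "integrable ?M (\<lambda>p. (u p)\<^sup>2)" if "square_integrable S u" for u
    using that by (simp add: square_integrable_def)
  define V where "V = ?I (\<lambda>p. (v1 p)\<^sup>2) + ?I (\<lambda>p. (v2 p)\<^sup>2)"
  define D where "D = ?I (\<lambda>p. (Dx S v1 p)\<^sup>2) + ?I (\<lambda>p. (Dy S v1 p)\<^sup>2) + ?I (\<lambda>p. (Dx S v2 p)\<^sup>2) + ?I (\<lambda>p. (Dy S v2 p)\<^sup>2)"
  have nonneg: "0 \<le> ?I (\<lambda>p. (u p)\<^sup>2)" for u :: field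
    by simp
  have "?I (\<lambda>p. (v1 p)\<^sup>2) \<le> 4 * ?I (\<lambda>p. (Dx S v1 p)\<^sup>2)" "?I (\<lambda>p. (v2 p)\<^sup>2) \<le> 4 * ?I (\<lambda>p. (Dx S v2 p)\<^sup>2)"
    using poincare_W12_0[OF S strip' basis(1)] v by auto
  then have "V \<le> 4 * (?I (\<lambda>p. (Dx S v1 p)\<^sup>2) + ?I (\<lambda>p. (Dx S v2 p)\<^sup>2))"
    unfolding V_def distrib_left by (rule add_mono)
  also have "\<dots> \<le> 4 * D"
    unfolding D_def by (intro mult_left_mono add_mono add_increasing2 nonneg) simp_all
  finally have "V \<le> 4 * D" .
  have "0 < V"
  proof -
    have "0 < ?I (\<lambda>p. (v1 p)\<^sup>2) \<or> 0 < ?I (\<lambda>p. (v2 p)\<^sup>2)"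
      using nz integral_power2_pos[OF L2v(1)] integral_power2_pos[OF L2v(2)] by (auto simp: is_zero_on_def)
    then show ?thesis
      using nonneg[of v1] nonneg[of v2] unfolding V_def by linarith
  qed
  let ?N = "\<lambda>p. Dx S v1 p * Dy S v2 p - Dy S v1 p * Dx S v2 p"
  have N_int: "integrable ?M (\<lambda>p. Dx S v1 p * Dy S v2 p)" "integrable ?M (\<lambda>p. Dy S v1 p * Dx S v2 p)"
    using Dv by (auto intro: square_integrable_mult_integrable)
  have N_0: "?I ?N = 0"
    using null_lagrangian_W12_0[OF S basis W(1) v(2)] N_int by simp
  let ?low = "\<lambda>p. (2 + L2) * ((Dx S v1 p)\<^sup>2 + (Dy S v1 p)\<^sup>2 + (Dx S v2 p)\<^sup>2 + (Dy S v2 p)\<^sup>2)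
    + 2 * \<bar>L2\<bar> * ?N p - ?\<kappa> * ?K * ((v1 p)\<^sup>2 + (v2 p)\<^sup>2)"
  note ints = sq_int[OF Dv(1)] sq_int[OF Dv(2)] sq_int[OF Dv(3)] sq_int[OF Dv(4)] sq_int[OF L2v(1)] sq_int[OF L2v(2)] N_int
  have low_int: "integrable ?M ?low"
    by (intro Bochner_Integration.integrable_add Bochner_Integration.integrable_diff integrable_mult_right ints)
  have "?I ?low = (2 + L2) * D + 2 * \<bar>L2\<bar> * ?I ?N - ?\<kappa> * ?K * V"
    unfolding D_def V_def using ints by (simp add: Bochner_Integration.integral_diff Bochner_Integration.integral_add)
  then have I_low: "?I ?low = (2 + L2) * D - ?\<kappa> * ?K * V"
    using N_0 by simp
  have "?I ?low \<le> ?I (second_variation A B C L lam L2 S q1 q2 q3 v1 v2 (\<lambda>p. 0))"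
  proof (rule integral_mono_AE[OF low_int int])
    show "AE p in ?M. ?low p \<le> second_variation A B C L lam L2 S q1 q2 q3 v1 v2 (\<lambda>p. 0) p"
      using weak_deriv_zero_AE[OF S basis(1)] weak_deriv_zero_AE[OF S basis(2)]
    proof eventually_elim
      case (elim p)
      have "?\<kappa> * (- ?K * ((v1 p)\<^sup>2 + (v2 p)\<^sup>2)) \<le> ?\<kappa> * d2f_b A B C (q1 p) (q2 p) (q3 p) (v1 p) (v2 p) 0"
        using \<open>L > 0\<close> by (intro mult_left_mono d2f_b_12_lower_bound \<open>A < 0\<close> \<open>C > 0\<close>) auto
      then have "- (?\<kappa> * ?K * ((v1 p)\<^sup>2 + (v2 p)\<^sup>2)) \<le> ?\<kappa> * d2f_b A B C (q1 p) (q2 p) (q3 p) (v1 p) (v2 p) 0"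
        by (simp only: mult_minus_left mult_minus_right mult.assoc)
      moreover have "2 * f_el L2 (Dx S v1 p) (Dy S v1 p) (Dx S v2 p) (Dy S v2 p) 0 0 =
          (2 + L2) * ((Dx S v1 p)\<^sup>2 + (Dy S v1 p)\<^sup>2 + (Dx S v2 p)\<^sup>2 + (Dy S v2 p)\<^sup>2) + 2 * \<bar>L2\<bar> * ?N p"
        by (simp add: f_el_def algebra_simps)
      ultimately show ?case
        unfolding second_variation_def elim by linarith
    qed
  qed
  moreover have "?\<kappa> * ?K * V \<le> ?\<kappa> * ?K * (4 * D)"
    using \<open>V \<le> 4 * D\<close> \<open>L > 0\<close> \<open>C > 0\<close> by (intro mult_left_mono) auto
  moreover have "?\<kappa> * ?K * (4 * D) \<le> L2 * D"
    using L2 \<open>V \<le> 4 * D\<close> \<open>0 < V\<close> mult_right_mono[OF L2, of D] by (simp add: mult_ac)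
  moreover have "0 < 2 * D"
    using \<open>V \<le> 4 * D\<close> \<open>0 < V\<close> by linarith
  ultimately show ?thesis
    unfolding I_low by (simp add: distrib_right)
qed

text \<open>
  The elastic cross terms all involve two different components, so only the gradient of \<open>v3\<close>
  contributes; the Poincare inequality then compares it with the bulk term.
\<close>

lemma second_variation_3_pos:
  fixes S :: "(real \<times> real) set"
  assumes S: "open S" "bounded S" and strip: "\<And>x y. (x, y) \<in> S \<Longrightarrow> \<bar>x\<bar> \<le> 1"
    and "A < 0" "C > 0" "L > 0"
    and L2: "lam\<^sup>2 / L * (4 * (6 * \<bar>A\<bar> + B\<^sup>2 / (3 * C))) \<le> L2"
    and v: "v3 \<in> W12_0 S" and nz: "\<not> is_zero_on S v3"
    and int: "integrable (lebesgue_on S) (second_variation A B C L lam L2 S q1 q2 q3 (\<lambda>p. 0) (\<lambda>p. 0) v3)"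
  shows "0 < integral\<^sup>L (lebesgue_on S) (second_variation A B C L lam L2 S q1 q2 q3 (\<lambda>p. 0) (\<lambda>p. 0) v3)"
proof -
  let ?M = "lebesgue_on S" and ?\<kappa> = "lam\<^sup>2 / L" and ?K = "6 * \<bar>A\<bar> + B\<^sup>2 / (3 * C)"
  let ?I = "integral\<^sup>L ?M"
  have basis: "(1::real, 0::real) \<in> Basis" "(0::real, 1::real) \<in> Basis"
    by (simp_all add: Basis_prod_def)
  have strip': "\<bar>z \<bullet> (1, 0)\<bar> \<le> 1" if "z \<in> S" for z
    using that strip[of "fst z" "snd z"] by (simp add: inner_prod_def)
  have W: "v3 \<in> W12 S"
    using v by (rule W12_0_W12)
  have sq_int: "integrable ?M (\<lambda>p. (u p)\<^sup>2)" if "square_integrable S u" for u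
    using that by (simp add: square_integrable_def)
  note ints = sq_int[OF W12_square_integrable[OF W]] sq_int[OF W12_weak_deriv_square_integrable[OF W basis(1)]]
    sq_int[OF W12_weak_deriv_square_integrable[OF W basis(2)]]
  define V where "V = ?I (\<lambda>p. (v3 p)\<^sup>2)"
  define D where "D = ?I (\<lambda>p. (Dx S v3 p)\<^sup>2) + ?I (\<lambda>p. (Dy S v3 p)\<^sup>2)"
  have nonneg: "0 \<le> ?I (\<lambda>p. (u p)\<^sup>2)" for u :: field
    by simp
  have "V \<le> 4 * ?I (\<lambda>p. (Dx S v3 p)\<^sup>2)"
    using poincare_W12_0[OF S strip' basis(1) v] by (simp add: V_def)
  also have "\<dots> \<le> 4 * D"
    unfolding D_def by simp
  finally have "V \<le> 4 * D" .
  have "0 < V"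
    unfolding V_def using nz integral_power2_pos[OF W12_square_integrable[OF W]] by (auto simp: is_zero_on_def)
  let ?low = "\<lambda>p. (6 + L2) * ((Dx S v3 p)\<^sup>2 + (Dy S v3 p)\<^sup>2) - ?\<kappa> * ?K * (v3 p)\<^sup>2"
  have low_int: "integrable ?M ?low"
    by (intro Bochner_Integration.integrable_add Bochner_Integration.integrable_diff integrable_mult_right ints)
  have I_low: "?I ?low = (6 + L2) * D - ?\<kappa> * ?K * V"
    unfolding D_def V_def using ints by (simp add: Bochner_Integration.integral_diff Bochner_Integration.integral_add)
  have "?I ?low \<le> ?I (second_variation A B C L lam L2 S q1 q2 q3 (\<lambda>p. 0) (\<lambda>p. 0) v3)"
  proof (rule integral_mono_AE[OF low_int int])
    show "AE p in ?M. ?low p \<le> second_variation A B C L lam L2 S q1 q2 q3 (\<lambda>p. 0) (\<lambda>p. 0) v3 p"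
      using weak_deriv_zero_AE[OF S basis(1)] weak_deriv_zero_AE[OF S basis(2)]
    proof eventually_elim
      case (elim p)
      have "?\<kappa> * (- ?K * (v3 p)\<^sup>2) \<le> ?\<kappa> * d2f_b A B C (q1 p) (q2 p) (q3 p) 0 0 (v3 p)"
        using \<open>L > 0\<close> by (intro mult_left_mono d2f_b_3_lower_bound \<open>A < 0\<close> \<open>C > 0\<close>) auto
      then have "- (?\<kappa> * ?K * (v3 p)\<^sup>2) \<le> ?\<kappa> * d2f_b A B C (q1 p) (q2 p) (q3 p) 0 0 (v3 p)"
        by (simp only: mult_minus_left mult_minus_right mult.assoc)
      moreover have "2 * f_el L2 0 0 0 0 (Dx S v3 p) (Dy S v3 p) = (6 + L2) * ((Dx S v3 p)\<^sup>2 + (Dy S v3 p)\<^sup>2)"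
        by (simp add: f_el_def algebra_simps)
      ultimately show ?case
        unfolding second_variation_def elim by linarith
    qed
  qed
  moreover have "?\<kappa> * ?K * V \<le> ?\<kappa> * ?K * (4 * D)"
    using \<open>V \<le> 4 * D\<close> \<open>L > 0\<close> \<open>C > 0\<close> by (intro mult_left_mono) auto
  moreover have "?\<kappa> * ?K * (4 * D) \<le> L2 * D"
    using L2 \<open>V \<le> 4 * D\<close> \<open>0 < V\<close> mult_right_mono[OF L2, of D] by (simp add: mult_ac)
  moreover have "0 < 6 * D"
    using \<open>V \<le> 4 * D\<close> \<open>0 < V\<close> by linarith
  ultimately show ?thesis
    unfolding I_low by (simp add: distrib_right)
qed

lemma Omega_open: "open (Omega \<epsilon>)"
proof -
  have "Omega \<epsilon> = {z. \<bar>fst z\<bar> < 1 \<and> \<bar>snd z\<bar> < 1 \<and> \<bar>fst z + snd z\<bar> < 2 - \<epsilon> \<and> \<bar>fst z - snd z\<bar> < 2 - \<epsilon>}"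
    by (auto simp: Omega_def)
  then show ?thesis
    by (simp only:) (intro open_Collect_conj open_Collect_less continuous_intros)
qed

lemma Omega_bounded: "bounded (Omega \<epsilon>)"
proof (rule bounded_subset)
  show "Omega \<epsilon> \<subseteq> cbox (-1, -1) (1, 1)"
    by (auto simp: Omega_def mem_box Basis_prod_def)
qed (rule bounded_cbox)

theorem proposition5p1:
  fixes M1 M2 M3 :: "real \<Rightarrow> real \<Rightarrow> real \<Rightarrow> real"
  assumes M_pos: "\<And>A B C. A < 0 \<Longrightarrow> B > 0 \<Longrightarrow> C > 0 \<Longrightarrow>
    M1 A B C > 0 \<and> M2 A B C > 0 \<and> M3 A B C > 0"
  shows "\<exists>c :: real \<Rightarrow> real \<Rightarrow> real \<Rightarrow> (real \<times> real) set \<Rightarrow> real.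
    \<forall>A B C \<epsilon> L lam L2 :: real. \<forall>q1 q2 q3.
      A < 0 \<longrightarrow> B > 0 \<longrightarrow> C > 0 \<longrightarrow> 0 < \<epsilon> \<longrightarrow> \<epsilon> < 1 \<longrightarrow> L > 0 \<longrightarrow> lam > 0 \<longrightarrow> L2 > -1 \<longrightarrow>
      L2 \<ge> lam\<^sup>2 / L * c A B C (Omega \<epsilon>) \<longrightarrow>
      (q1, q2, q3) \<in> A_star A B C \<epsilon> (M1 A B C) (M2 A B C) (M3 A B C) \<longrightarrow>
      critical_point A B C L lam L2 \<epsilon> q1 q2 q3 \<longrightarrow>
      stable_q1_q2 A B C L lam L2 (Omega \<epsilon>) q1 q2 q3 \<and>
      stable_q3 A B C L lam L2 (Omega \<epsilon>) q1 q2 q3"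
proof (rule exI[of _ "\<lambda>A B C _. 4 * (6 * \<bar>A\<bar> + B\<^sup>2 / (3 * C))"], intro allI impI)
  fix A B C \<epsilon> L lam L2 :: real and q1 q2 q3 :: field
  assume par: "A < 0" "C > 0" "L > 0"
    and L2: "L2 \<ge> lam\<^sup>2 / L * (4 * (6 * \<bar>A\<bar> + B\<^sup>2 / (3 * C)))"
    and q: "(q1, q2, q3) \<in> A_star A B C \<epsilon> (M1 A B C) (M2 A B C) (M3 A B C)"
  let ?S = "Omega \<epsilon>"
  note S = Omega_open[of \<epsilon>] Omega_bounded[of \<epsilon>]
  have strip: "\<bar>x\<bar> \<le> 1" if "(x, y) \<in> ?S" for x y
    using that by (auto simp: Omega_def)
  have "lam\<^sup>2 / L * (4 * (2 * \<bar>A\<bar> + B\<^sup>2 / (3 * C))) \<le> lam\<^sup>2 / L * (4 * (6 * \<bar>A\<bar> + B\<^sup>2 / (3 * C)))"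
    using par by (intro mult_left_mono) auto
  with L2 have L2': "lam\<^sup>2 / L * (4 * (2 * \<bar>A\<bar> + B\<^sup>2 / (3 * C))) \<le> L2"
    by linarith
  have qW: "q1 \<in> W12 ?S" "q2 \<in> W12 ?S" "q3 \<in> W12 ?S"
    using q by (auto simp: A_star_def A_0_def)
  have q4: "quartic_integrable ?S q1" "quartic_integrable ?S q2" "quartic_integrable ?S q3"
    using q has_boundary_values_quartic_integrable[OF S] by (auto simp: A_star_def A_0_def)
  note Z = zero_W12_0[OF S]
  note W4 = W12_0_quartic_integrable[OF S]
  have "stable_q1_q2 A B C L lam L2 ?S q1 q2 q3"
    unfolding stable_q1_q2_def
  proof (intro ballI impI)
    fix v1 v2 assume v: "v1 \<in> W12_0 ?S" "v2 \<in> W12_0 ?S" and nz: "\<not> (is_zero_on ?S v1 \<and> is_zero_on ?S v2)"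
    note J = second_variation_J[OF S qW W12_0_W12[OF v(1)] W12_0_W12[OF v(2)] W12_0_W12[OF Z] q4
        W4[OF v(1)] W4[OF v(2)] W4[OF Z], of A B C L lam L2]
    show "\<exists>d>0. has_second_deriv_at_0
        (\<lambda>t. J A B C L lam L2 ?S (\<lambda>p. q1 p + t * v1 p) (\<lambda>p. q2 p + t * v2 p) q3) d"
      using J(2) second_variation_12_pos[OF S strip par L2' v nz J(1)]
      by (intro exI[of _ "integral\<^sup>L (lebesgue_on ?S) (second_variation A B C L lam L2 ?S q1 q2 q3 v1 v2 (\<lambda>x. 0))"]) simp
  qed
  moreover have "stable_q3 A B C L lam L2 ?S q1 q2 q3"
    unfolding stable_q3_def
  proof (intro ballI impI)
    fix v3 assume v: "v3 \<in> W12_0 ?S" and nz: "\<not> is_zero_on ?S v3"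
    note J = second_variation_J[OF S qW W12_0_W12[OF Z] W12_0_W12[OF Z] W12_0_W12[OF v] q4
        W4[OF Z] W4[OF Z] W4[OF v], of A B C L lam L2]
    show "\<exists>d>0. has_second_deriv_at_0 (\<lambda>t. J A B C L lam L2 ?S q1 q2 (\<lambda>p. q3 p + t * v3 p)) d"
      using J(2) second_variation_3_pos[OF S strip par L2 v nz J(1)]
      by (intro exI[of _ "integral\<^sup>L (lebesgue_on ?S) (second_variation A B C L lam L2 ?S q1 q2 q3 (\<lambda>x. 0) (\<lambda>x. 0) v3)"]) simp
  qed
  ultimately show "stable_q1_q2 A B C L lam L2 ?S q1 q2 q3 \<and> stable_q3 A B C L lam L2 ?S q1 q2 q3" ..
qed

end
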